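(* Every $E$-convex Banach space has the fixed point property for nonexpansive mappings.
   Context: A map $T:C\to C$ on a subset $C$ of a Banach space is nonexpansive if $\|Tx-Ty\|\le\|x-y\|$ for all $x,y\in C$. A Banach space $X$ has the fixed point property (for nonexpansive mappings) if, for every nonempty, closed, bounded, convex subset $C$ of $X$, every nonexpansive mapping of $C$ into itself has a fixed point. Let $B_X$ denote the closed unit ball of $X$. For $\varepsilon>0$, a convex subset $A$ of $B_X$ is an $\varepsilon$-flat if $A\cap(1-\varepsilon)B_X=\emptyset$. A collection $\mathcal{D}$ of $\varepsilon$-flats is jointly complemented if, for each pair of distinct $\varepsilon$-flats $A$ and $B$ in $\mathcal{D}$, the sets $A\cap B$ and $A\cap(-B)$ are nonempty. For $n\in\mathbb{N}$ define $$E(n,X)=\inf\{\varepsilon>0 : B_X \text{ contains a jointly complemented collection of } \varepsilon\text{-flats of cardinality } n\}.$$ A Banach space $X$ is $E$-convex if $E(n,X)>0$ for some $n\in\mathbb{N}$. *)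

theory Defs
  imports "HOL-Analysis.Analysis"
begin

definition nonexpansive_on :: "'a::real_normed_vector set \<Rightarrow> ('a \<Rightarrow> 'a) \<Rightarrow> bool" where
  "nonexpansive_on C T \<longleftrightarrow> (\<forall>x\<in>C. \<forall>y\<in>C. norm (T x - T y) \<le> norm (x - y))"

text \<open>A Banach space is represented by a type of class \<^class>\<open>banach\<close>; properties of the space
  take the type as an argument.\<close>

definition fixed_point_property :: "'a::banach itself \<Rightarrow> bool" where
  "fixed_point_property X \<longleftrightarrow>
     (\<forall>(C :: 'a set) T. C \<noteq> {} \<longrightarrow> closed C \<longrightarrow> bounded C \<longrightarrow> convex C \<longrightarrow>
        T ` C \<subseteq> C \<longrightarrow> nonexpansive_on C T \<longrightarrow> (\<exists>x\<in>C. T x = x))"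

definition flat :: "real \<Rightarrow> 'a::real_normed_vector set \<Rightarrow> bool" where
  "flat \<epsilon> A \<longleftrightarrow>
     convex A \<and> A \<subseteq> cball 0 1 \<and> A \<inter> (\<lambda>x. (1 - \<epsilon>) *\<^sub>R x) ` cball 0 1 = {}"

definition jointly_complemented :: "'a::real_normed_vector set set \<Rightarrow> bool" where
  "jointly_complemented D \<longleftrightarrow>
     pairwise (\<lambda>A B. A \<inter> B \<noteq> {} \<and> A \<inter> uminus ` B \<noteq> {}) D"

text \<open>The infimum is taken in the extended reals, so that it is \<open>\<infinity>\<close> when no collection of
  cardinality \<open>n\<close> exists for any \<open>\<epsilon>\<close> (as in a one-dimensional space with \<open>n \<ge> 2\<close>);
  \<^term>\<open>Inf {} :: real\<close> would be an unspecified number. Including \<open>n = 0\<close> is harmless, since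
  the empty collection makes the value \<open>0\<close>.\<close>

definition E_const :: "nat \<Rightarrow> 'a::real_normed_vector itself \<Rightarrow> ereal" where
  "E_const n X =
     (INF \<epsilon> \<in> {\<epsilon>::real. \<epsilon> > 0 \<and>
        (\<exists>D :: 'a set set. finite D \<and> card D = n \<and> (\<forall>A\<in>D. flat \<epsilon> A) \<and> jointly_complemented D)}.
      ereal \<epsilon>)"

definition E_convex :: "'a::banach itself \<Rightarrow> bool" where
  "E_convex X \<longleftrightarrow> (\<exists>n. E_const n X > 0)"

end

theory Submission
  imports Defs
begin

text \<open>
  Suppose that \<open>T\<close> is a nonexpansive self-map of a closed bounded convex set without a fixed point.
  The proof produces, for every \<open>n\<close> and every \<open>\<epsilon> \<in> (0, 1)\<close>, a jointly complemented collection of \<open>n\<close>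
  \<open>\<epsilon>\<close>-flats. All flats have the form \<open>{x. \<parallel>x\<parallel> \<le> 1 \<and> f x > 1 - \<epsilon>}\<close> for a functional \<open>f\<close> of norm at
  most 1, so joint complementation only asks, for each pair of functionals, for a point of the unit
  ball where both are close to 1 and a point where one is close to 1 and the other close to \<open>-1\<close>
  (\<open>jointly_complemented_slices\<close>). There are two sources of such functionals.

  The first is failure of weak compactness, excluded in \<open>bounded_ultrafilter_weak_limit\<close>: in an
  \<open>E\<close>-convex Banach space every bounded ultrafilter converges weakly. A bounded ultrafilter \<open>U\<close>
  without weak limit defines a point of the bidual at positive distance from the space, because the
  space is complete. Iterated limits of \<open>\<parallel>a\<^sub>1 x\<^sub>1 + \<dots> + a\<^sub>r x\<^sub>r\<parallel>\<close> along \<open>U\<close> then give a norm on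
  coefficient sequences that is unchanged when zeros are inserted and that dominates a multiple of
  every tail sum of the coefficients. Following James, let \<open>K\<^sub>m\<close> be the infimum of the norms of
  sequences whose tail sums take the values \<open>1, -1, 1, \<dots>\<close> at \<open>m\<close> successive places. This grows at
  most linearly and stays away from 0, so \<open>K\<^sub>m\<^sub>+\<^sub>1 / K\<^sub>m\<close> is close to 1 for some \<open>m\<close>. Cut a
  near-optimal sequence for \<open>K\<^sub>m\<^sub>+\<^sub>1\<close> into blocks at its alternation places and interleave \<open>n\<close>
  copies of it block by block. If the first \<open>k\<close> copies get the sign \<open>+\<close> and the others \<open>-\<close>, the tail
  sums of the combination take the values \<open>n\<close> and \<open>-n\<close> alternately at \<open>m\<close> places, so its norm is at
  least \<open>n K\<^sub>m\<close>. After normalisation this is a family of vectors \<open>u\<^sub>j\<close> in the unit ball with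
  \<open>\<parallel>u\<^sub>1 + \<dots> + u\<^sub>k - u\<^sub>k\<^sub>+\<^sub>1 - \<dots> - u\<^sub>n\<parallel>\<close> close to \<open>n\<close> for all \<open>k\<close> (\<open>sign_change_vectors\<close>), and
  functionals norming these sums define the flats.

  Weak limits provide a minimal invariant closed convex set \<open>K\<close>; let \<open>d > 0\<close> be its diameter. By the
  Goebel-Karlovitz lemma, almost fixed points of \<open>T\<close> in \<open>K\<close> are at distance almost \<open>d\<close> from any
  given point of \<open>K\<close>. Let \<open>U\<close> be an ultrafilter of almost fixed points with weak limit \<open>p\<close>. To each
  \<open>x \<in> K\<close> apply a long averaged iteration of \<open>T\<close> that starts from the midpoint of \<open>x\<close> and \<open>p\<close>. The
  result \<open>w x\<close> is almost fixed, hence \<open>\<parallel>w x - p\<parallel>\<close> is almost \<open>d\<close>; but the map \<open>w\<close> is Lipschitz on \<open>K\<close>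
  with constant \<open>1/2\<close> and \<open>\<parallel>w x - x\<parallel>\<close> is at most about \<open>d/2\<close>. Let \<open>q\<close> be the weak limit of \<open>w\<close> along
  \<open>U\<close>. Then \<open>\<parallel>q - p\<parallel> \<le> d/2\<close> and \<open>\<parallel>w x - q\<parallel> \<le> d/2\<close>, so a functional \<open>F x\<close> norming \<open>w x - p\<close> has
  values close to \<open>d/2\<close> at both \<open>q - p\<close> and \<open>w x - q\<close>. Finitely many \<open>x\<^sub>i\<close> can be chosen such that
  \<open>F x\<^sub>i (w x\<^sub>j - q)\<close> is at most a given small number for \<open>i \<noteq> j\<close>. Up to the factor \<open>2/d\<close>, the point
  \<open>q - p\<close> then lies in all the slices defined by the \<open>F x\<^sub>i\<close>, and the point \<open>w x\<^sub>i - w x\<^sub>j\<close>, of norm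
  at most \<open>d/2\<close>, lies in the slice of \<open>x\<^sub>i\<close> and in the negative of the slice of \<open>x\<^sub>j\<close>
  (\<open>flats_from_minimal_set\<close>).
\<close>

section \<open>Ultrafilters\<close>

definition ultrafilter :: "'i filter \<Rightarrow> bool" where
  "ultrafilter U \<longleftrightarrow> U \<noteq> bot \<and> (\<forall>P. eventually P U \<or> eventually (\<lambda>x. \<not> P x) U)"

text \<open>A filter that is minimal among the proper filters below \<open>F\<close> decides every predicate: restricting it
  to a predicate that it does not refute cannot make it smaller.\<close>

lemma ultrafilter_refining_exists:
  assumes "F \<noteq> bot"
  shows "\<exists>U. ultrafilter U \<and> U \<le> F"
proof -
  define A where "A = {G. G \<noteq> bot \<and> G \<le> F}"
  have "\<exists>m\<in>A. \<forall>a\<in>A. a \<le> m \<longrightarrow> a = m"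
  proof (rule predicate_Zorn[where P = "\<lambda>a b. b \<le> a"])
    show "partial_order_on A (relation_of (\<lambda>a b. b \<le> a) A)"
      by (auto simp: partial_order_on_def preorder_on_def refl_on_def trans_def antisym_def
          relation_of_def)
  next
    fix C assume C: "C \<in> Chains (relation_of (\<lambda>a b. b \<le> a) A)"
    then have CA: "C \<subseteq> A" and ch: "\<And>a b. a \<in> C \<Longrightarrow> b \<in> C \<Longrightarrow> a \<le> b \<or> b \<le> a"
      by (auto simp: Chains_def relation_of_def)
    show "\<exists>u\<in>A. \<forall>a\<in>C. u \<le> a"
    proof (cases "C = {}")
      case True
      then show ?thesis using assms by (auto simp: A_def)
    next
      case False
      have "\<not> eventually (\<lambda>_. False) (Inf C)"
      proof (subst eventually_Inf_base[OF False])
        show "\<exists>x\<in>C. x \<le> inf G H" if "G \<in> C" "H \<in> C" for G H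
          using ch[OF that] that by (auto intro: bexI[of _ G] bexI[of _ H])
        show "\<not> (\<exists>b\<in>C. eventually (\<lambda>_. False) b)"
          using CA by (auto simp: A_def trivial_limit_def)
      qed
      moreover have "Inf C \<le> F"
        using False CA by (auto simp: A_def intro: Inf_lower2)
      ultimately have "Inf C \<in> A"
        by (auto simp: A_def trivial_limit_def)
      then show ?thesis by (auto intro: Inf_lower)
    qed
  qed
  then obtain U where U: "U \<in> A" and min: "\<And>G. G \<in> A \<Longrightarrow> G \<le> U \<Longrightarrow> G = U" by blast
  have "eventually P U" if "\<not> eventually (\<lambda>x. \<not> P x) U" for P
  proof -
    have "inf U (principal {x. P x}) \<noteq> bot"
      using that by (auto simp: trivial_limit_def eventually_inf_principal)
    then have "inf U (principal {x. P x}) = U"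
      using U by (intro min) (auto simp: A_def intro: le_infI1)
    moreover have "eventually P (inf U (principal {x. P x}))"
      by (simp add: eventually_inf_principal)
    ultimately show ?thesis by simp
  qed
  then show ?thesis using U by (auto simp: ultrafilter_def A_def)
qed

text \<open>This is the form in which compactness arguments use ultrafilters below: a weak limit of \<open>U\<close> is a
  common point of all closed convex members of the chain.\<close>

lemma ultrafilter_containing_chain:
  assumes "\<S> \<noteq> {}" "\<And>A B. A \<in> \<S> \<Longrightarrow> B \<in> \<S> \<Longrightarrow> A \<subseteq> B \<or> B \<subseteq> A" "{} \<notin> \<S>"
  obtains U where "ultrafilter U" "\<And>A. A \<in> \<S> \<Longrightarrow> \<forall>\<^sub>F x in U. x \<in> A"
proof -
  have base: "eventually P (INF A\<in>\<S>. principal A) \<longleftrightarrow> (\<exists>A\<in>\<S>. eventually P (principal A))" for P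
  proof (rule eventually_INF_base[OF assms(1)])
    show "\<exists>x\<in>\<S>. principal x \<le> inf (principal A) (principal B)" if "A \<in> \<S>" "B \<in> \<S>" for A B
      using assms(2)[OF that]
      by (rule disjE) (use that in \<open>force intro: bexI[of _ A] bexI[of _ B]\<close>)+
  qed
  have "(INF A\<in>\<S>. principal A) \<noteq> bot"
    using assms(3) unfolding trivial_limit_def base by (auto simp: eventually_principal)
  then obtain U where U: "ultrafilter U" "U \<le> (INF A\<in>\<S>. principal A)"
    using ultrafilter_refining_exists by blast
  have "\<forall>\<^sub>F x in U. x \<in> A" if "A \<in> \<S>" for A
    by (rule filter_leD[OF U(2)]) (use that in \<open>auto simp: base eventually_principal\<close>)
  with U(1) that show thesis by blast
qed

lemma ultrafilter_filtermap: "ultrafilter U \<Longrightarrow> ultrafilter (filtermap g U)"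
  by (simp add: ultrafilter_def eventually_filtermap filtermap_bot_iff)

lemma ultrafilter_tendsto_compact:
  assumes U: "ultrafilter U" and "compact S" and ev: "\<forall>\<^sub>F x in U. g x \<in> S"
  obtains l where "(g \<longlongrightarrow> l) U"
proof -
  let ?V = "filtermap g U"
  have V: "ultrafilter ?V" using U by (rule ultrafilter_filtermap)
  moreover have "\<forall>\<^sub>F y in ?V. y \<in> S" using ev by (simp add: eventually_filtermap)
  ultimately obtain l where l: "inf (nhds l) ?V \<noteq> bot"
    using \<open>compact S\<close> unfolding compact_filter ultrafilter_def by blast
  have "eventually (\<lambda>y. y \<in> S) ?V" if S: "open S" "l \<in> S" for S
  proof (rule ccontr)
    assume "\<not> eventually (\<lambda>y. y \<in> S) ?V"
    then have "eventually (\<lambda>y. y \<notin> S) ?V" using V by (auto simp: ultrafilter_def)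
    moreover have "eventually (\<lambda>y. y \<in> S) (nhds l)" using S by (rule eventually_nhds_in_open)
    ultimately have "eventually (\<lambda>_. False) (inf (nhds l) ?V)"
      unfolding eventually_inf by blast
    then show False using l by (simp add: trivial_limit_def)
  qed
  then have "(g \<longlongrightarrow> l) U"
    by (intro topological_tendstoI) (simp add: eventually_filtermap)
  then show thesis by (rule that)
qed

lemma ultrafilter_tendsto_Lim:
  fixes g :: "'i \<Rightarrow> real"
  assumes U: "ultrafilter U" and ev: "\<forall>\<^sub>F x in U. \<bar>g x\<bar> \<le> B"
  shows "(g \<longlongrightarrow> Lim U g) U"
proof -
  have "\<forall>\<^sub>F x in U. g x \<in> {-B..B}" using ev by eventually_elim auto
  then obtain l where l: "(g \<longlongrightarrow> l) U"
    using ultrafilter_tendsto_compact[OF U compact_Icc] by blast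
  moreover have "U \<noteq> bot" using U by (simp add: ultrafilter_def)
  ultimately show ?thesis by (simp add: tendsto_Lim)
qed

section \<open>Norming functionals\<close>

text \<open>The core of the Hahn-Banach theorem: a minimal element among the sublinear functionals below \<open>p\<close>
  is linear.\<close>

lemma linear_below_sublinear:
  fixes p :: "'a::real_vector \<Rightarrow> real"
  assumes sub: "\<And>x y. p (x + y) \<le> p x + p y"
    and hom: "\<And>c x. 0 \<le> c \<Longrightarrow> p (c *\<^sub>R x) = c * p x"
  obtains f where "linear f" "\<And>x. f x \<le> p x"
proof -
  define sublin where "sublin q \<longleftrightarrow> (\<forall>x y. q (x + y) \<le> q x + q y) \<and>
    (\<forall>c x. 0 \<le> c \<longrightarrow> q (c *\<^sub>R x) = c * q x)" for q :: "'a \<Rightarrow> real"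
  have lower: "- q (- x) \<le> q x" if "sublin q" for q x
  proof -
    have "q 0 = 0" using that unfolding sublin_def by (metis order_refl mult_zero_left scaleR_zero_left)
    moreover have "q (x + - x) \<le> q x + q (- x)" using that unfolding sublin_def by blast
    ultimately show ?thesis by simp
  qed
  define A where "A = {q. sublin q \<and> q \<le> p}"
  have pA: "p \<in> A" using assms by (auto simp: A_def sublin_def)
  have "\<exists>m\<in>A. \<forall>a\<in>A. a \<le> m \<longrightarrow> a = m"
  proof (rule predicate_Zorn[where P = "\<lambda>a b. b \<le> a"])
    show "partial_order_on A (relation_of (\<lambda>a b. b \<le> a) A)"
      by (auto simp: partial_order_on_def preorder_on_def refl_on_def trans_def antisym_def
          relation_of_def intro: order_trans)
  next
    fix C assume C: "C \<in> Chains (relation_of (\<lambda>a b. b \<le> a) A)"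
    then have CA: "C \<subseteq> A" and ch: "\<And>a b. a \<in> C \<Longrightarrow> b \<in> C \<Longrightarrow> a \<le> b \<or> b \<le> a"
      by (auto simp: Chains_def relation_of_def)
    show "\<exists>u\<in>A. \<forall>a\<in>C. u \<le> a"
    proof (cases "C = {}")
      case True
      then show ?thesis using pA by auto
    next
      case False
      define u where "u x = (INF q\<in>C. q x)" for x
      have bdd: "bdd_below ((\<lambda>q. q x) ` C)" for x
      proof (rule bdd_belowI2)
        fix q assume "q \<in> C"
        then have "sublin q" "q (- x) \<le> p (- x)" using CA by (auto simp: A_def le_fun_def)
        then show "- p (- x) \<le> q x" using lower[of q x] by linarith
      qed
      have u_le: "u x \<le> q x" if "q \<in> C" for q x
        unfolding u_def using bdd that by (rule cINF_lower)
      have u_less: "\<exists>q\<in>C. q x < b" if "u x < b" for x b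
        using that unfolding u_def by (subst (asm) cINF_less_iff[OF False bdd]) auto
      have uadd: "u (x + y) \<le> u x + u y" for x y
      proof (rule field_le_epsilon)
        fix e :: real assume "e > 0"
        then obtain q1 q2 where q: "q1 \<in> C" "q1 x < u x + e/2" "q2 \<in> C" "q2 y < u y + e/2"
          using u_less[of x "u x + e/2"] u_less[of y "u y + e/2"] by auto
        obtain q where "q \<in> C" "q \<le> q1" "q \<le> q2" using ch[OF q(1,3)] q by blast
        moreover from this have "q (x + y) \<le> q x + q y" using CA by (auto simp: A_def sublin_def)
        ultimately show "u (x + y) \<le> u x + u y + e"
          using u_le[of q "x + y"] q by (auto simp: le_fun_def) (smt (verit, best) field_sum_of_halves)
      qed
      have uhom: "u (c *\<^sub>R x) = c * u x" if c: "0 \<le> c" for c x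
      proof -
        have eq: "q (c *\<^sub>R x) = c * q x" if "q \<in> C" for q
          using CA that c by (auto simp: A_def sublin_def)
        show ?thesis
        proof (cases "c = 0")
          case True
          have "(INF q\<in>C. q (0 *\<^sub>R x)) = (INF q\<in>C. 0)"
            using eq True by (intro INF_cong) auto
          then show ?thesis using False True by (simp add: u_def)
        next
          case c0: False
          with c have c: "c > 0" by simp
          show ?thesis
          proof (rule antisym)
            have "u (c *\<^sub>R x) / c \<le> u x"
              unfolding u_def[of x]
            proof (rule cINF_greatest[OF False])
              fix q assume "q \<in> C"
              then show "u (c *\<^sub>R x) / c \<le> q x"
                using u_le[of q "c *\<^sub>R x"] eq[of q] c by (simp add: field_simps)
            qed
            then show "u (c *\<^sub>R x) \<le> c * u x" using c by (simp add: field_simps)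
            show "c * u x \<le> u (c *\<^sub>R x)"
              unfolding u_def[of "c *\<^sub>R x"]
              by (rule cINF_greatest[OF False]) (simp add: u_le eq c less_imp_le mult_left_mono)
          qed
        qed
      qed
      have "u \<le> p"
      proof -
        obtain q where "q \<in> C" using False by blast
        then show ?thesis using u_le[of q] CA by (force simp: A_def le_fun_def intro: order_trans)
      qed
      then have "u \<in> A" using uadd uhom by (auto simp: A_def sublin_def)
      then show ?thesis using u_le by (auto simp: le_fun_def)
    qed
  qed
  then obtain m where mA: "m \<in> A" and min: "\<And>q. q \<in> A \<Longrightarrow> q \<le> m \<Longrightarrow> q = m" by blast
  then have m: "sublin m" "\<And>x. m x \<le> p x" by (auto simp: A_def le_fun_def)
  have madd: "m (x + y) \<le> m x + m y" for x y using m(1) by (simp add: sublin_def)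
  have mhom: "m (c *\<^sub>R x) = c * m x" if "0 \<le> c" for c x using m(1) that by (simp add: sublin_def)
  have super: "m x + m z \<le> m (x + z)" for x z
  proof -
    \<comment> \<open>This functional lies below \<open>m\<close> and is affine in the direction \<open>z\<close>; it equals \<open>m\<close> by
        minimality.\<close>
    define q where "q x = (INF t\<in>{0..}. m (x + t *\<^sub>R z) - t * m z)" for x
    have bdd: "bdd_below ((\<lambda>t. m (x + t *\<^sub>R z) - t * m z) ` {0..})" for x
    proof (rule bdd_belowI2)
      fix t :: real assume "t \<in> {0..}"
      then show "- m (- x) \<le> m (x + t *\<^sub>R z) - t * m z"
        using madd[of "x + t *\<^sub>R z" "- x"] mhom[of t z] by auto
    qed
    have q_le: "q x \<le> m (x + t *\<^sub>R z) - t * m z" if "t \<ge> 0" for x t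
      unfolding q_def using bdd by (rule cINF_lower) (use that in auto)
    have q_less: "\<exists>t\<ge>0. m (x + t *\<^sub>R z) - t * m z < b" if "q x < b" for x b
      using that unfolding q_def by (subst (asm) cINF_less_iff[OF _ bdd]) auto
    have qadd: "q (x + y) \<le> q x + q y" for x y
    proof (rule field_le_epsilon)
      fix e :: real assume "e > 0"
      then obtain s t where st: "s \<ge> 0" "m (x + s *\<^sub>R z) - s * m z < q x + e/2"
          "t \<ge> 0" "m (y + t *\<^sub>R z) - t * m z < q y + e/2"
        using q_less[of x "q x + e/2"] q_less[of y "q y + e/2"] by auto
      have "q (x + y) \<le> m ((x + y) + (s + t) *\<^sub>R z) - (s + t) * m z"
        using st by (intro q_le) auto
      also have "m ((x + y) + (s + t) *\<^sub>R z) \<le> m (x + s *\<^sub>R z) + m (y + t *\<^sub>R z)"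
        using madd[of "x + s *\<^sub>R z" "y + t *\<^sub>R z"] by (simp add: algebra_simps)
      finally show "q (x + y) \<le> q x + q y + e"
        using st by (simp add: algebra_simps)
    qed
    have qhom_le: "q (c *\<^sub>R x) \<le> c * q x" if c: "0 < c" for c x
    proof -
      have "q (c *\<^sub>R x) / c \<le> q x"
        unfolding q_def[of x]
      proof (rule cINF_greatest)
        fix t :: real assume t: "t \<in> {0..}"
        have "q (c *\<^sub>R x) \<le> m (c *\<^sub>R x + (c * t) *\<^sub>R z) - c * t * m z"
          using t c by (intro q_le) auto
        also have "m (c *\<^sub>R x + (c * t) *\<^sub>R z) = c * m (x + t *\<^sub>R z)"
          using mhom[of c "x + t *\<^sub>R z"] c by (simp add: algebra_simps)
        finally show "q (c *\<^sub>R x) / c \<le> m (x + t *\<^sub>R z) - t * m z"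
          using c by (simp add: field_simps)
      qed auto
      then show ?thesis using c by (simp add: field_simps)
    qed
    have qhom: "q (c *\<^sub>R x) = c * q x" if c: "0 \<le> c" for c x
    proof (cases "c = 0")
      case True
      have "m 0 = 0" using mhom[of 0 0] by simp
      then have "q 0 = 0" using mhom by (simp add: q_def)
      with True show ?thesis by simp
    next
      case False
      then have c: "c > 0" using c by simp
      have "c * q x = c * q (inverse c *\<^sub>R (c *\<^sub>R x))" using c by simp
      also have "\<dots> \<le> c * (inverse c * q (c *\<^sub>R x))"
        using c by (intro mult_left_mono qhom_le) auto
      finally show ?thesis using qhom_le[OF c, of x] c by (simp add: field_simps)
    qed
    have "q \<le> m" using q_le[of 0] by (auto simp: le_fun_def)
    moreover from this have "q \<in> A" using qadd qhom mA by (auto simp: A_def sublin_def)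
    ultimately have "q = m" by (intro min)
    then show ?thesis using q_le[of 1 x] by simp
  qed
  have add: "m (x + y) = m x + m y" for x y using super[of x y] madd[of x y] by simp
  have neg: "m (- x) = - m x" for x using add[of x "- x"] mhom[of 0 x] by simp
  have "linear m"
  proof (rule linearI)
    show "m (c *\<^sub>R x) = c *\<^sub>R m x" for c x
      using mhom[of c x] mhom[of "- c" x] neg[of "c *\<^sub>R x"] by (cases "c \<ge> 0") auto
  qed (rule add)
  with m(2) that show thesis by blast
qed

text \<open>The one-sided bound is equivalent to operator norm at most 1, since \<open>f (- x) = - f x\<close>; it is the
  form that domination by a sublinear functional delivers.\<close>

definition unit_functional :: "('a::real_normed_vector \<Rightarrow> real) \<Rightarrow> bool" where
  "unit_functional f \<longleftrightarrow> linear f \<and> (\<forall>x. f x \<le> norm x)"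

context
  fixes f :: "'a::real_normed_vector \<Rightarrow> real"
  assumes f: "unit_functional f"
begin

lemma unit_functional_simps:
  "f (x + y) = f x + f y" "f (x - y) = f x - f y" "f (- x) = - f x"
  "f (c *\<^sub>R x) = c * f x" "f (sum g I) = (\<Sum>i\<in>I. f (g i))" "f 0 = 0"
  using f by (auto simp: unit_functional_def linear_add linear_diff linear_neg linear_scale
      linear_sum linear_0)

lemma unit_functional_le_norm: "f x \<le> norm x"
  using f by (simp add: unit_functional_def)

lemma unit_functional_uminus: "unit_functional (\<lambda>x. - f x)"
  using f unit_functional_le_norm[of "- _"]
  by (auto simp: unit_functional_def unit_functional_simps(3) intro: linear_compose_neg)

lemma unit_functional_abs_le_norm: "\<bar>f x\<bar> \<le> norm x"
  using unit_functional_le_norm[of x] unit_functional_le_norm[of "- x"] unit_functional_simps(3)[of x]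
  by auto

end

text \<open>The functional is found below the sublinear gauge
  \<open>p z = (INF t \<ge> 0, c \<in> C. \<parallel>z + t (c - y)\<parallel> - t \<theta>)\<close>. Taking \<open>t = 0\<close> gives \<open>p \<le> norm\<close>, taking \<open>t = 1\<close> gives
  \<open>p (y - c) \<le> - \<theta>\<close>, and the distance bound is what makes \<open>p\<close> finite. A singleton \<open>C\<close> yields norming
  functionals.\<close>

lemma separating_functional:
  fixes C :: "'a::real_normed_vector set"
  assumes "convex C" "C \<noteq> {}" and far: "\<And>c. c \<in> C \<Longrightarrow> \<theta> \<le> norm (c - y)"
  obtains f where "unit_functional f" "\<And>c. c \<in> C \<Longrightarrow> f y + \<theta> \<le> f c"
proof -
  define S where "S = {0::real..} \<times> C"
  define h where "h z = (\<lambda>(t::real, c). norm (z + t *\<^sub>R (c - y)) - t * \<theta>)" for z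
  define p where "p z = (INF s\<in>S. h z s)" for z
  have S: "S \<noteq> {}" using assms(2) by (auto simp: S_def)
  have bdd: "bdd_below (h z ` S)" for z
  proof (rule bdd_belowI2)
    fix s assume "s \<in> S"
    then obtain t c where s: "s = (t, c)" "t \<ge> 0" "c \<in> C" by (auto simp: S_def)
    have "t * \<theta> \<le> t * norm (c - y)" using s far by (intro mult_left_mono) auto
    also have "\<dots> = norm (t *\<^sub>R (c - y))" using s by simp
    also have "\<dots> \<le> norm (z + t *\<^sub>R (c - y)) + norm z"
      by (metis add_diff_cancel_left' norm_triangle_ineq4)
    finally show "- norm z \<le> h z s" using s by (simp add: h_def)
  qed
  have p_le: "p z \<le> h z s" if "s \<in> S" for z s
    unfolding p_def using bdd that by (rule cINF_lower)
  have p_less: "\<exists>s\<in>S. h z s < b" if "p z < b" for z b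
    using that unfolding p_def by (subst (asm) cINF_less_iff[OF S bdd])
  have padd: "p (x + z) \<le> p x + p z" for x z
  proof (rule field_le_epsilon)
    fix e :: real assume "e > 0"
    then obtain s1 s2 where "s1 \<in> S" "h x s1 < p x + e/2" "s2 \<in> S" "h z s2 < p z + e/2"
      using p_less[of x "p x + e/2"] p_less[of z "p z + e/2"] by auto
    then obtain t c t' c' where *: "t \<ge> 0" "c \<in> C" "t' \<ge> 0" "c' \<in> C"
      "h x (t, c) < p x + e/2" "h z (t', c') < p z + e/2" by (auto simp: S_def)
    obtain c'' where c'': "c'' \<in> C" "(t + t') *\<^sub>R (c'' - y) = t *\<^sub>R (c - y) + t' *\<^sub>R (c' - y)"
    proof (cases "t + t' = 0")
      case True
      then have "t = 0" "t' = 0" using * by auto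
      then show ?thesis using * by (intro that[of c]) auto
    next
      case False
      then have pos: "t + t' > 0" using * by simp
      have "(t / (t + t')) *\<^sub>R c + (t' / (t + t')) *\<^sub>R c' \<in> C"
        using * pos by (intro convexD[OF \<open>convex C\<close>]) (auto simp flip: add_divide_distrib)
      moreover have "(t + t') *\<^sub>R ((t / (t + t')) *\<^sub>R c + (t' / (t + t')) *\<^sub>R c' - y)
          = t *\<^sub>R (c - y) + t' *\<^sub>R (c' - y)"
      proof -
        have "(t + t') *\<^sub>R (t / (t + t')) *\<^sub>R c = t *\<^sub>R c"
          "(t + t') *\<^sub>R (t' / (t + t')) *\<^sub>R c' = t' *\<^sub>R c'" using pos by auto
        then show ?thesis by (simp only: scaleR_add_right scaleR_diff_right) (simp add: algebra_simps)
      qed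
      ultimately show ?thesis by (rule that)
    qed
    have "p (x + z) \<le> h (x + z) (t + t', c'')"
      using * c'' by (intro p_le) (auto simp: S_def)
    also have "\<dots> = norm ((x + t *\<^sub>R (c - y)) + (z + t' *\<^sub>R (c' - y))) - (t + t') * \<theta>"
      by (simp only: h_def prod.case c''(2)) (simp only: add_ac)
    also have "\<dots> \<le> h x (t, c) + h z (t', c')"
      using norm_triangle_ineq[of "x + t *\<^sub>R (c - y)" "z + t' *\<^sub>R (c' - y)"]
      by (simp add: h_def algebra_simps)
    finally show "p (x + z) \<le> p x + p z + e" using * by linarith
  qed
  have phom_le: "p (a *\<^sub>R x) \<le> a * p x" if a: "0 < a" for a x
  proof -
    have "p (a *\<^sub>R x) / a \<le> p x"
      unfolding p_def[of x]
    proof (rule cINF_greatest[OF S])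
      fix s assume "s \<in> S"
      then obtain t c where s: "s = (t, c)" "t \<ge> 0" "c \<in> C" by (auto simp: S_def)
      have "p (a *\<^sub>R x) \<le> h (a *\<^sub>R x) (a * t, c)" using s a by (intro p_le) (auto simp: S_def)
      also have "\<dots> = norm (a *\<^sub>R (x + t *\<^sub>R (c - y))) - a * t * \<theta>"
        by (simp add: h_def algebra_simps)
      also have "\<dots> = a * h x s" using a 
        by (simp add: h_def s algebra_simps del: scaleR_right_diff_distrib scaleR_add_right)
      finally show "p (a *\<^sub>R x) / a \<le> h x s" using a by (simp add: field_simps)
    qed
    then show ?thesis using a by (simp add: field_simps)
  qed
  have p_norm: "p z \<le> norm z" for z
  proof -
    obtain c where "c \<in> C" using assms(2) by blast
    then show ?thesis using p_le[of "(0, c)" z] by (simp add: S_def h_def)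
  qed
  have p0: "p 0 = 0"
  proof (rule antisym)
    show "p 0 \<le> 0" using p_norm[of 0] by simp
    show "0 \<le> p 0"
      unfolding p_def[of 0]
    proof (rule cINF_greatest[OF S])
      fix s assume "s \<in> S"
      then show "0 \<le> h 0 s" using far by (auto simp: S_def h_def mult_left_mono)
    qed
  qed
  have phom: "p (a *\<^sub>R x) = a * p x" if a: "0 \<le> a" for a x
  proof (cases "a = 0")
    case True
    then show ?thesis by (simp add: p0)
  next
    case False
    then have a: "a > 0" using a by simp
    have "a * p x = a * p (inverse a *\<^sub>R (a *\<^sub>R x))" using a by simp
    also have "\<dots> \<le> a * (inverse a * p (a *\<^sub>R x))"
      using a by (intro mult_left_mono phom_le) auto
    finally show ?thesis using phom_le[OF a, of x] a by (simp add: field_simps)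
  qed
  obtain f where f: "linear f" "\<And>x. f x \<le> p x"
    using linear_below_sublinear[of p] padd phom by blast
  show thesis
  proof (rule that)
    show uf: "unit_functional f"
      using f p_norm by (auto simp: unit_functional_def intro: order_trans)
    fix c assume c: "c \<in> C"
    have "f (y - c) \<le> h (y - c) (1, c)"
      using c by (intro order_trans[OF f(2) p_le]) (auto simp: S_def)
    then show "f y + \<theta> \<le> f c" by (simp add: h_def unit_functional_simps[OF uf])
  qed
qed

lemma norming_functional:
  obtains f where "unit_functional f" "f x = norm x"
proof -
  obtain f where f: "unit_functional f" "f 0 + norm x \<le> f x"
    using separating_functional[of "{x}" "norm x" 0] by auto
  then have "f x = norm x"
    using unit_functional_le_norm[OF f(1), of x] by (simp add: unit_functional_simps[OF f(1)])
  with f(1) show thesis by (rule that)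
qed

section \<open>Flats cut out by functionals\<close>

text \<open>Distinct indices give distinct slices: a slice that meets its own negative would contain a point
  where \<open>f i\<close> is both above \<open>1 - \<epsilon> > 0\<close> and below \<open>0\<close>.\<close>

lemma jointly_complemented_slices:
  fixes f :: "nat \<Rightarrow> 'a::real_normed_vector \<Rightarrow> real"
  assumes f: "\<And>i. i < n \<Longrightarrow> unit_functional (f i)" and "0 < \<epsilon>" "\<epsilon> < 1"
    and p: "\<And>i j. i < n \<Longrightarrow> j < n \<Longrightarrow> i \<noteq> j \<Longrightarrow>
      \<exists>p. norm p \<le> 1 \<and> f i p > 1 - \<epsilon> \<and> f j p > 1 - \<epsilon>"
    and q: "\<And>i j. i < n \<Longrightarrow> j < n \<Longrightarrow> i \<noteq> j \<Longrightarrow>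
      \<exists>q. norm q \<le> 1 \<and> f i q > 1 - \<epsilon> \<and> f j q < - (1 - \<epsilon>)"
  shows "\<exists>D :: 'a set set. finite D \<and> card D = n \<and> (\<forall>A\<in>D. flat \<epsilon> A) \<and> jointly_complemented D"
proof -
  define A where "A i = {x. norm x \<le> 1 \<and> f i x > 1 - \<epsilon>}" for i
  have flat: "flat \<epsilon> (A i)" if "i < n" for i
  proof -
    note fi = f[OF that]
    have "convex (cball 0 1 \<inter> f i -` {1 - \<epsilon> <..})"
    proof (rule convex_Int[OF convex_cball convex_linear_vimage])
      show "linear (f i)" using fi by (simp add: unit_functional_def)
    qed (rule convex_real_interval)
    moreover have "A i = cball 0 1 \<inter> f i -` {1 - \<epsilon> <..}" by (auto simp: A_def)
    moreover have "(1 - \<epsilon>) *\<^sub>R x \<notin> A i" if "norm x \<le> 1" for x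
    proof -
      have "f i x \<le> 1" using unit_functional_le_norm[OF fi, of x] that by linarith
      then have "(1 - \<epsilon>) * f i x \<le> (1 - \<epsilon>) * 1" using \<open>\<epsilon> < 1\<close> by (intro mult_left_mono) auto
      then show ?thesis by (simp add: A_def unit_functional_simps[OF fi])
    qed
    ultimately show ?thesis by (auto simp: flat_def A_def)
  qed
  have inter: "A i \<inter> A j \<noteq> {}" "A i \<inter> uminus ` A j \<noteq> {}" if ij: "i < n" "j < n" "i \<noteq> j" for i j
  proof -
    show "A i \<inter> A j \<noteq> {}" using p[OF ij] by (auto simp: A_def)
    obtain x where x: "norm x \<le> 1" "f i x > 1 - \<epsilon>" "f j x < - (1 - \<epsilon>)" using q[OF ij] by blast
    have "- x \<in> A j" using x by (simp add: A_def unit_functional_simps[OF f[OF ij(2)]])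
    then have "x \<in> uminus ` A j" by force
    then show "A i \<inter> uminus ` A j \<noteq> {}" using x by (auto simp: A_def)
  qed
  have "inj_on A {..<n}"
  proof (rule inj_onI, rule ccontr)
    fix i j assume ij: "i \<in> {..<n}" "j \<in> {..<n}" "A i = A j" "i \<noteq> j"
    then obtain x where "x \<in> A j" "- x \<in> A j" using inter(2)[of i j] by auto
    moreover have "f j (- x) = - f j x" using f[of j] ij by (simp add: unit_functional_simps)
    ultimately show False using \<open>\<epsilon> < 1\<close> by (auto simp: A_def)
  qed
  then have "card (A ` {..<n}) = n" by (simp add: card_image)
  moreover have "jointly_complemented (A ` {..<n})"
    unfolding jointly_complemented_def
  proof (rule pairwiseI)
    fix X Y assume "X \<in> A ` {..<n}" "Y \<in> A ` {..<n}" "X \<noteq> Y"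
    then obtain i j where "X = A i" "Y = A j" "i < n" "j < n" "i \<noteq> j" by blast
    then show "X \<inter> Y \<noteq> {} \<and> X \<inter> uminus ` Y \<noteq> {}" using inter[of i j] by simp
  qed
  ultimately show ?thesis using flat by (intro exI[of _ "A ` {..<n}"]) auto
qed

lemma E_convex_obstruction:
  assumes "E_convex TYPE('a::banach)"
  obtains n \<epsilon> where "0 < \<epsilon>" "\<epsilon> < 1"
    "\<nexists>D :: 'a set set. finite D \<and> card D = n \<and> (\<forall>A\<in>D. flat \<epsilon> A) \<and> jointly_complemented D"
proof -
  obtain n where n: "E_const n TYPE('a) > 0" using assms by (auto simp: E_convex_def)
  then have "0 < min (E_const n TYPE('a)) 1" by simp
  then obtain \<epsilon>' where "0 < \<epsilon>'" "\<epsilon>' < min (E_const n TYPE('a)) 1"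
    using dense by blast
  then obtain \<epsilon> where E: "0 < \<epsilon>" "\<epsilon> < 1" "ereal \<epsilon> < E_const n TYPE('a)"
    by (cases \<epsilon>') auto
  show thesis
  proof (rule that[OF E(1,2)])
    show "\<nexists>D :: 'a set set. finite D \<and> card D = n \<and> (\<forall>A\<in>D. flat \<epsilon> A) \<and> jointly_complemented D"
    proof
      assume "\<exists>D :: 'a set set. finite D \<and> card D = n \<and> (\<forall>A\<in>D. flat \<epsilon> A) \<and> jointly_complemented D"
      then have "E_const n TYPE('a) \<le> ereal \<epsilon>"
        unfolding E_const_def using E(1) by (intro INF_lower) auto
      then show False using E(3) by simp
    qed
  qed
qed

text \<open>The functional norming the \<open>k\<close>-th signed sum is close to 1 at \<open>u 0, \<dots>, u (k - 1)\<close> and close to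
  \<open>-1\<close> at the remaining vectors. For \<open>k \<ge> 1\<close> all these functionals agree at \<open>u 0\<close>, and the \<open>k\<close>-th and the
  \<open>l\<close>-th one, \<open>k < l\<close>, have opposite signs at \<open>u k\<close>.\<close>

lemma sign_change_vectors_imp_flats:
  fixes u :: "nat \<Rightarrow> 'a::real_normed_vector"
  assumes u: "\<And>j. j < Suc n \<Longrightarrow> norm (u j) \<le> 1" and \<epsilon>: "0 < \<epsilon>" "\<epsilon> < 1"
    and big: "\<And>k. k \<le> Suc n \<Longrightarrow> norm (\<Sum>j<Suc n. (if j < k then 1 else - 1) *\<^sub>R u j) > real (Suc n) - \<epsilon>"
  shows "\<exists>D :: 'a set set. finite D \<and> card D = n \<and> (\<forall>A\<in>D. flat \<epsilon> A) \<and> jointly_complemented D"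
proof -
  define s where "s k j = (if j < k then 1 else - 1 :: real)" for k j :: nat
  have "\<exists>f. unit_functional f \<and> f (\<Sum>j<Suc n. s k j *\<^sub>R u j) = norm (\<Sum>j<Suc n. s k j *\<^sub>R u j)" for k
    using norming_functional by blast
  then obtain f where f: "\<And>k. unit_functional (f k)"
    "\<And>k. f k (\<Sum>j<Suc n. s k j *\<^sub>R u j) = norm (\<Sum>j<Suc n. s k j *\<^sub>R u j)"
    by metis
  \<comment> \<open>A sum of \<open>n + 1\<close> numbers at most 1 that exceeds \<open>n + 1 - \<epsilon>\<close> has only terms above
      \<open>1 - \<epsilon>\<close>.\<close>
  have summand: "s k j * f k (u j) > 1 - \<epsilon>" if "k \<le> Suc n" "j < Suc n" for k j
  proof -
    have le1: "s k i * f k (u i) \<le> 1" if "i < Suc n" for i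
      using unit_functional_abs_le_norm[OF f(1)[of k], of "u i"] u[OF that]
      by (auto simp: s_def abs_le_iff)
    have "real (Suc n) - \<epsilon> < (\<Sum>i<Suc n. s k i * f k (u i))"
      using big[OF \<open>k \<le> Suc n\<close>] f(2)[of k] unfolding unit_functional_simps[OF f(1)] s_def by simp
    also have "\<dots> = s k j * f k (u j) + (\<Sum>i\<in>{..<Suc n} - {j}. s k i * f k (u i))"
      using that by (intro sum.remove) auto
    also have "(\<Sum>i\<in>{..<Suc n} - {j}. s k i * f k (u i)) \<le> (\<Sum>i\<in>{..<Suc n} - {j}. 1)"
      using le1 by (intro sum_mono) auto
    also have "\<dots> = real n" using that by simp
    finally show ?thesis by simp
  qed
  show ?thesis
  proof (rule jointly_complemented_slices[of n "\<lambda>i. f (Suc i)"])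
    fix i j assume ij: "i < n" "j < n" "i \<noteq> j"
    show "\<exists>p. norm p \<le> 1 \<and> f (Suc i) p > 1 - \<epsilon> \<and> f (Suc j) p > 1 - \<epsilon>"
      using summand[of "Suc i" 0] summand[of "Suc j" 0] ij u[of 0]
      by (intro exI[of _ "u 0"]) (auto simp: s_def)
    show "\<exists>q. norm q \<le> 1 \<and> f (Suc i) q > 1 - \<epsilon> \<and> f (Suc j) q < - (1 - \<epsilon>)"
    proof (cases "i < j")
      case True
      \<comment> \<open>\<open>u (i + 1)\<close> carries a minus sign in the \<open>i\<close>-th sum and a plus sign in the \<open>j\<close>-th.\<close>
      then show ?thesis using summand[of "Suc i" "Suc i"] summand[of "Suc j" "Suc i"] ij u[of "Suc i"]
        by (intro exI[of _ "- u (Suc i)"]) (auto simp: s_def unit_functional_simps[OF f(1)])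
    next
      case False
      then show ?thesis using summand[of "Suc i" "Suc j"] summand[of "Suc j" "Suc j"] ij u[of "Suc j"]
        by (intro exI[of _ "u (Suc j)"]) (auto simp: s_def)
    qed
  qed (use f \<epsilon> in auto)
qed

section \<open>Coefficient sequences with alternating tail sums\<close>

text \<open>Reading from the front, one finds \<open>m\<close> tails, each a tail of the preceding one, with the sums
  \<open>\<sigma>, - \<sigma>, \<sigma>, \<dots>\<close>.\<close>

primrec alternating_tails :: "nat \<Rightarrow> real \<Rightarrow> real list \<Rightarrow> bool" where
  "alternating_tails 0 \<sigma> as \<longleftrightarrow> True"
| "alternating_tails (Suc m) \<sigma> as \<longleftrightarrow>
    (\<exists>p q. as = p @ q \<and> sum_list q = \<sigma> \<and> alternating_tails m (- \<sigma>) q)"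

lemma alternating_tails_prefix:
  "alternating_tails m \<sigma> q \<Longrightarrow> alternating_tails m \<sigma> (p @ q)"
  by (cases m) (auto, metis append.assoc)

lemma alternating_tails_scale:
  "alternating_tails m \<sigma> as \<Longrightarrow> alternating_tails m (c * \<sigma>) (map ((*) c) as)"
proof (induction m arbitrary: \<sigma> as)
  case (Suc m)
  then obtain p q where q: "as = p @ q" "sum_list q = \<sigma>" "alternating_tails m (- \<sigma>) q" by auto
  then have "map ((*) c) as = map ((*) c) p @ map ((*) c) q"
    "sum_list (map ((*) c) q) = c * \<sigma>" "alternating_tails m (- (c * \<sigma>)) (map ((*) c) q)"
    using Suc.IH[of "- \<sigma>" q] by (simp_all add: sum_list_const_mult)
  then show ?case unfolding alternating_tails.simps(2) by blast
qed simp

lemma alternating_tails_Suc: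
  "alternating_tails (Suc m) \<sigma> as \<Longrightarrow> alternating_tails m (- \<sigma>) as"
  by (auto intro: alternating_tails_prefix)

lemma alternating_tails_exists:
  "\<exists>as. alternating_tails (Suc m) \<sigma> as \<and> sum_list as = \<sigma> \<and>
    (\<Sum>a\<leftarrow>as. \<bar>a\<bar>) \<le> 2 * \<bar>\<sigma>\<bar> * real (Suc m)"
proof (induction m arbitrary: \<sigma>)
  case 0
  have "alternating_tails (Suc 0) \<sigma> [\<sigma>]"
    by (simp, metis append_Nil sum_list.Cons sum_list.Nil add.right_neutral)
  then show ?case by (intro exI[of _ "[\<sigma>]"]) auto
next
  case (Suc m)
  obtain as where as: "alternating_tails (Suc m) (- \<sigma>) as" "sum_list as = - \<sigma>"
      "(\<Sum>a\<leftarrow>as. \<bar>a\<bar>) \<le> 2 * \<bar>\<sigma>\<bar> * real (Suc m)"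
    using Suc.IH[of "- \<sigma>"] by auto
  have "alternating_tails (Suc m) (- \<sigma>) ((2 * \<sigma>) # as)"
    using alternating_tails_prefix[OF as(1), of "[2 * \<sigma>]"] by simp
  then have "alternating_tails (Suc (Suc m)) \<sigma> ((2 * \<sigma>) # as)"
    unfolding alternating_tails.simps(2)[of "Suc m"]
    using as(2) by (intro exI[of _ "[]"] exI[of _ "(2 * \<sigma>) # as"]) simp
  moreover have "(\<Sum>a\<leftarrow>(2 * \<sigma>) # as. \<bar>a\<bar>) \<le> 2 * \<bar>\<sigma>\<bar> * real (Suc (Suc m))"
    using as(3) by (simp add: algebra_simps abs_mult)
  ultimately show ?case using as(2) by (intro exI[of _ "(2 * \<sigma>) # as"]) simp
qed

text \<open>The sequence cut at its alternation places. The last block has sum \<open>\<plusminus> \<sigma>\<close>, and each earlier one has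
  the sum \<open>\<plusminus> 2 \<sigma>\<close> that moves the tail sum from one sign to the other.\<close>

fun alternating_blocks :: "real \<Rightarrow> real list list \<Rightarrow> bool" where
  "alternating_blocks \<sigma> [] \<longleftrightarrow> False"
| "alternating_blocks \<sigma> [B] \<longleftrightarrow> sum_list B = \<sigma>"
| "alternating_blocks \<sigma> (B # B' # Bs) \<longleftrightarrow>
    sum_list B = 2 * \<sigma> \<and> alternating_blocks (- \<sigma>) (B' # Bs)"

lemma alternating_blocks_sum: "alternating_blocks \<sigma> Bs \<Longrightarrow> sum_list (concat Bs) = \<sigma>"
  by (induction \<sigma> Bs rule: alternating_blocks.induct) auto

lemma alternating_tails_blocks:
  assumes "alternating_tails (Suc m) \<sigma> as"
  shows "\<exists>p Bs. as = p @ concat Bs \<and> alternating_blocks \<sigma> Bs \<and> length Bs = Suc m"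
  using assms
proof (induction m arbitrary: \<sigma> as)
  case 0
  then obtain p q where "as = p @ q" "sum_list q = \<sigma>" by auto
  then show ?case by (intro exI[of _ p] exI[of _ "[q]"]) simp
next
  case (Suc m)
  then obtain p q where q: "as = p @ q" "sum_list q = \<sigma>" "alternating_tails (Suc m) (- \<sigma>) q"
    using alternating_tails.simps(2)[of "Suc m" \<sigma> as] by blast
  then obtain p' Bs where Bs: "q = p' @ concat Bs" "alternating_blocks (- \<sigma>) Bs" "length Bs = Suc m"
    using Suc.IH by blast
  have "sum_list p' = 2 * \<sigma>"
    using q(2) Bs(1) alternating_blocks_sum[OF Bs(2)] by simp
  then have "alternating_blocks \<sigma> (p' # Bs)" using Bs by (cases Bs) auto
  then show ?case using q(1) Bs by (intro exI[of _ p] exI[of _ "p' # Bs"]) simp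
qed

text \<open>Interleaved copies of a block sequence: every block is repeated once for each index in \<open>js\<close>, and
  each coefficient carries the index of its copy. The linear combination of the copies with
  coefficients \<open>w j\<close> is obtained by \<open>weigh w\<close>, so all combinations live on one common list of positions.\<close>

definition tag_block :: "nat list \<Rightarrow> real list \<Rightarrow> (real \<times> nat) list" where
  "tag_block js B = concat (map (\<lambda>j. map (\<lambda>a. (a, j)) B) js)"

definition interleave :: "nat list \<Rightarrow> real list list \<Rightarrow> (real \<times> nat) list" where
  "interleave js Bs = concat (map (tag_block js) Bs)"

definition weigh :: "(nat \<Rightarrow> real) \<Rightarrow> (real \<times> nat) list \<Rightarrow> real list" where
  "weigh w cs = map (\<lambda>(a, j). w j * a) cs"

lemma weigh_append [simp]: "weigh w (cs @ ds) = weigh w cs @ weigh w ds"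
  by (simp add: weigh_def)

lemma sum_weigh_tag_block: "sum_list (weigh w (tag_block js B)) = sum_list (map w js) * sum_list B"
  by (induction js)
    (simp_all add: tag_block_def weigh_def comp_def sum_list_const_mult distrib_right)

lemma interleave_Cons: "interleave js (B # Bs) = tag_block js B @ interleave js Bs"
  by (simp add: interleave_def)

lemma tag_block_append: "tag_block (js @ ks) B = tag_block js B @ tag_block ks B"
  by (simp add: tag_block_def)

lemma sum_weigh_interleave:
  "sum_list (weigh w (interleave js Bs)) = sum_list (map w js) * sum_list (concat Bs)"
  by (induction Bs)
    (simp_all add: interleave_Cons sum_weigh_tag_block algebra_simps,
     simp add: interleave_def weigh_def)

text \<open>Let \<open>a\<close> and \<open>b\<close> be the total weights of the copies in \<open>js\<close> and in \<open>ks\<close>. At the place inside a round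
  where the copies in \<open>js\<close> have already passed their block \<open>B\<close> and those in \<open>ks\<close> have not, the former
  have tail sum \<open>- \<sigma>\<close> and the latter \<open>\<sigma>\<close>, which makes \<open>- (a - b) \<sigma>\<close> in total. The next round gives
  the opposite value. One alternation is lost compared with the number of blocks, because these places lie
  between two alternation places of the individual copies.\<close>

lemma alternating_tails_interleave:
  assumes "alternating_blocks \<sigma> Bs" "length Bs = Suc m"
  shows "alternating_tails m (- (sum_list (map w js) - sum_list (map w ks)) * \<sigma>)
    (weigh w (interleave (js @ ks) Bs))"
  using assms
proof (induction \<sigma> Bs arbitrary: m rule: alternating_blocks.induct)
  case (3 \<sigma> B B' Bs)
  let ?a = "sum_list (map w js)" and ?b = "sum_list (map w ks)"
  obtain l where m: "m = Suc l" using "3.prems" by (cases m) auto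
  have tails: "alternating_tails l (- (?a - ?b) * - \<sigma>) (weigh w (interleave (js @ ks) (B' # Bs)))"
    using "3.prems" m by (intro "3.IH") auto
  have "sum_list (concat (B' # Bs)) = - \<sigma>"
    using "3.prems" by (intro alternating_blocks_sum) auto
  then have "sum_list (weigh w (interleave (js @ ks) (B' # Bs))) = (?a + ?b) * - \<sigma>"
    by (subst sum_weigh_interleave) simp
  then have "sum_list (weigh w (tag_block ks B) @ weigh w (interleave (js @ ks) (B' # Bs)))
      = - (?a - ?b) * \<sigma>"
    using "3.prems" by (simp add: sum_weigh_tag_block algebra_simps)
  moreover have "alternating_tails l (- (- (?a - ?b) * \<sigma>))
      (weigh w (tag_block ks B) @ weigh w (interleave (js @ ks) (B' # Bs)))"
    using alternating_tails_prefix[OF tails] by simp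
  moreover have "weigh w (interleave (js @ ks) (B # B' # Bs)) = weigh w (tag_block js B) @
      (weigh w (tag_block ks B) @ weigh w (interleave (js @ ks) (B' # Bs)))"
    by (simp add: interleave_Cons[of _ B] tag_block_append)
  ultimately show ?case unfolding m alternating_tails.simps(2) by blast
qed auto

text \<open>A single copy differs from the original sequence only by inserted zeros, to which iterated norms
  are insensitive.\<close>

lemma filter_weigh_interleave_unit:
  assumes "j < n"
  shows "filter (\<lambda>a. a \<noteq> 0) (weigh (\<lambda>i. if i = j then 1 else 0) (interleave [0..<n] Bs))
    = filter (\<lambda>a. a \<noteq> 0) (concat Bs)"
proof -
  have "filter (\<lambda>a. a \<noteq> 0) (weigh (\<lambda>i. if i = j then 1 else 0) (tag_block [0..<n] B))
    = (if j < n then filter (\<lambda>a. a \<noteq> 0) B else [])" for B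
    by (induction n) (auto simp: tag_block_def weigh_def comp_def filter_map filter_empty_conv map_idI)
  with assms show ?thesis
    by (induction Bs) (simp_all add: interleave_Cons, simp add: interleave_def weigh_def)
qed

definition lin_comb :: "real list \<Rightarrow> 'a::real_vector list \<Rightarrow> 'a" where
  "lin_comb as xs = (\<Sum>(a, x)\<leftarrow>zip as xs. a *\<^sub>R x)"

lemma lin_comb_simps [simp]:
  "lin_comb [] xs = 0" "lin_comb (a # as) (x # xs) = a *\<^sub>R x + lin_comb as xs"
  by (simp_all add: lin_comb_def)

lemma lin_comb_weigh:
  assumes "\<And>c. c \<in> set cs \<Longrightarrow> snd c < n" "length xs = length cs"
  shows "lin_comb (weigh w cs) xs =
    (\<Sum>j<n. w j *\<^sub>R lin_comb (weigh (\<lambda>i. if i = j then 1 else 0) cs) xs)"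
  using assms(2,1)
proof (induction xs cs rule: list_induct2)
  case Nil
  then show ?case by (simp add: weigh_def)
next
  case (Cons x xs c cs)
  obtain a i where c: "c = (a, i)" by (cases c)
  have i: "i < n" using Cons.prems[of c] c by simp
  have w: "weigh v (c # cs) = (v i * a) # weigh v cs" for v by (simp add: weigh_def c)
  have "(\<Sum>j<n. w j *\<^sub>R ((if i = j then 1 else 0) * a) *\<^sub>R x) = (\<Sum>j<n. if i = j then (w j * a) *\<^sub>R x else 0)"
    by (intro sum.cong) auto
  also have "\<dots> = (w i * a) *\<^sub>R x" using i by simp
  finally show ?case using Cons by (simp add: w scaleR_add_right sum.distrib)
qed

lemma exponential_beats_linear:
  fixes \<theta> \<delta> c :: real
  assumes "\<theta> > 0" "\<delta> > 0"
  shows "\<exists>m. c * real (Suc m) < \<theta> * (1 + \<delta>) ^ m"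
proof -
  define x where "x = 1 / (1 + \<delta>)"
  have x: "0 < x" "x < 1" using assms by (auto simp: x_def)
  have "(\<lambda>m. c * (real m * x ^ m + x ^ m)) \<longlonglongrightarrow> c * (0 + 0)"
    using x by (intro tendsto_intros powser_times_n_limit_0 LIMSEQ_realpow_zero) auto
  then have "\<forall>\<^sub>F m in sequentially. c * (real m * x ^ m + x ^ m) < \<theta>"
    using assms by (intro order_tendstoD) auto
  then obtain m where "c * (real m * x ^ m + x ^ m) < \<theta>"
    by (auto simp: eventually_sequentially)
  then have "c * (real m * x ^ m + x ^ m) * (1 + \<delta>) ^ m < \<theta> * (1 + \<delta>) ^ m"
    using assms by (intro mult_strict_right_mono) auto
  moreover have "x ^ m * (1 + \<delta>) ^ m = 1"
    using assms by (simp add: x_def flip: power_mult_distrib)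
  ultimately have "c * (real m + 1) < \<theta> * (1 + \<delta>) ^ m"
    by (simp add: mult.assoc flip: distrib_right) (simp add: algebra_simps)
  then show ?thesis by (auto simp: algebra_simps)
qed

section \<open>Iterated limits of norms along an ultrafilter\<close>

text \<open>For \<open>y = 0\<close> this is the seminorm of a spreading model generated by \<open>U\<close>: vectors are finite coefficient
  sequences, and only the order of their nonzero entries matters. The offset \<open>y\<close> is there for the
  recursion.\<close>

primrec iterated_norm :: "'a::real_normed_vector filter \<Rightarrow> 'a \<Rightarrow> real list \<Rightarrow> real" where
  "iterated_norm U y [] = norm y"
| "iterated_norm U y (a # as) = Lim U (\<lambda>x. iterated_norm U (y + a *\<^sub>R x) as)"

context
  fixes U :: "'a::real_normed_vector filter" and M :: real
  assumes U: "ultrafilter U" and bdd: "\<forall>\<^sub>F x in U. norm x \<le> M"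
begin

lemma ultrafilter_nontrivial: "U \<noteq> bot"
  using U by (simp add: ultrafilter_def)

lemma functional_tendsto_Lim:
  assumes "unit_functional f"
  shows "(f \<longlongrightarrow> Lim U f) U"
proof (rule ultrafilter_tendsto_Lim[OF U])
  show "\<forall>\<^sub>F x in U. \<bar>f x\<bar> \<le> M"
    using bdd by eventually_elim (rule order_trans[OF unit_functional_abs_le_norm[OF assms]])
qed

text \<open>Boundedness and convergence have to be proved together: the limit in the recursion exists because
  the iterated norm of the tail is bounded on bounded sets, and the bounds pass to the limit.\<close>

lemma iterated_norm_bounds:
  "0 \<le> iterated_norm U y as \<and> iterated_norm U y as \<le> norm y + M * (\<Sum>a\<leftarrow>as. \<bar>a\<bar>) \<and>
   (\<forall>a. ((\<lambda>x. iterated_norm U (y + a *\<^sub>R x) as) \<longlongrightarrow> iterated_norm U y (a # as)) U)"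
proof (induction as arbitrary: y)
  have tend: "((\<lambda>x. iterated_norm U (y + a *\<^sub>R x) as) \<longlongrightarrow> iterated_norm U y (a # as)) U \<and>
      0 \<le> iterated_norm U y (a # as) \<and>
      iterated_norm U y (a # as) \<le> norm y + M * (\<Sum>a\<leftarrow>a # as. \<bar>a\<bar>)"
    if bnd: "\<And>y. 0 \<le> iterated_norm U y as \<and> iterated_norm U y as \<le> norm y + M * (\<Sum>a\<leftarrow>as. \<bar>a\<bar>)"
    for as y a
  proof -
    have ev: "\<forall>\<^sub>F x in U. iterated_norm U (y + a *\<^sub>R x) as \<le> norm y + M * (\<Sum>a\<leftarrow>a # as. \<bar>a\<bar>)"
      using bdd
    proof eventually_elim
      case (elim x)
      have "norm (y + a *\<^sub>R x) \<le> norm y + \<bar>a\<bar> * norm x"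
        by (metis norm_scaleR norm_triangle_ineq)
      also have "\<dots> \<le> norm y + \<bar>a\<bar> * M" using elim by (auto intro: mult_left_mono)
      finally show ?case using bnd[of "y + a *\<^sub>R x"] by (simp add: algebra_simps)
    qed
    then have "\<forall>\<^sub>F x in U. \<bar>iterated_norm U (y + a *\<^sub>R x) as\<bar> \<le> norm y + M * (\<Sum>a\<leftarrow>a # as. \<bar>a\<bar>)"
      by eventually_elim (use bnd in \<open>simp add: abs_of_nonneg\<close>)
    then have t: "((\<lambda>x. iterated_norm U (y + a *\<^sub>R x) as) \<longlongrightarrow> iterated_norm U y (a # as)) U"
      using ultrafilter_tendsto_Lim[OF U] by simp
    show ?thesis
    proof (intro conjI)
      show "0 \<le> iterated_norm U y (a # as)"
        using tendsto_lowerbound[OF t _ ultrafilter_nontrivial, of 0] bnd by simp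
      show "iterated_norm U y (a # as) \<le> norm y + M * (\<Sum>a\<leftarrow>a # as. \<bar>a\<bar>)"
        using tendsto_upperbound[OF t ev ultrafilter_nontrivial] .
    qed (rule t)
  qed
  {
    case Nil
    show ?case using tend[of "[]"] by simp
  next
    case (Cons a as)
    have "\<And>y. 0 \<le> iterated_norm U y (a # as) \<and>
        iterated_norm U y (a # as) \<le> norm y + M * (\<Sum>a\<leftarrow>a # as. \<bar>a\<bar>)"
      using tend[of as] Cons by blast
    then show ?case using tend[of "a # as"] by blast
  }
qed

lemmas iterated_norm_nonneg = conjunct1[OF iterated_norm_bounds]
lemmas iterated_norm_upper = conjunct1[OF conjunct2[OF iterated_norm_bounds]]
lemmas iterated_norm_tendsto = spec[OF conjunct2[OF conjunct2[OF iterated_norm_bounds]]]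

lemma iterated_norm_filter: "iterated_norm U y (filter (\<lambda>a. a \<noteq> 0) as) = iterated_norm U y as"
  by (induction as arbitrary: y) (auto intro!: tendsto_Lim[symmetric] ultrafilter_nontrivial)

lemma iterated_norm_scale:
  "iterated_norm U (c *\<^sub>R y) (map ((*) c) as) = \<bar>c\<bar> * iterated_norm U y as"
proof (induction as arbitrary: y)
  case (Cons a as)
  have "((\<lambda>x. \<bar>c\<bar> * iterated_norm U (y + a *\<^sub>R x) as) \<longlongrightarrow> \<bar>c\<bar> * iterated_norm U y (a # as)) U"
    by (intro tendsto_intros iterated_norm_tendsto)
  moreover have "\<bar>c\<bar> * iterated_norm U (y + a *\<^sub>R x) as =
      iterated_norm U (c *\<^sub>R y + (c * a) *\<^sub>R x) (map ((*) c) as)" for x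
    using Cons.IH[of "y + a *\<^sub>R x"] by (simp add: scaleR_add_right)
  ultimately show ?case
    using tendsto_Lim[OF ultrafilter_nontrivial] by simp
qed simp

text \<open>Each limit replaces \<open>f x\<close> by \<open>Lim U f\<close>, so that only the sum of the coefficients survives.\<close>

lemma iterated_norm_functional:
  assumes f: "unit_functional f"
  shows "f y + Lim U f * sum_list as \<le> iterated_norm U y as"
proof (induction as arbitrary: y)
  case Nil
  then show ?case using unit_functional_le_norm[OF f] by simp
next
  case (Cons a as)
  have "((\<lambda>x. f y + a * f x + Lim U f * sum_list as) \<longlongrightarrow>
      f y + a * Lim U f + Lim U f * sum_list as) U"
    by (intro tendsto_intros functional_tendsto_Lim f)
  from tendsto_le[OF ultrafilter_nontrivial iterated_norm_tendsto[of y a as] this]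
  have "f y + a * Lim U f + Lim U f * sum_list as \<le> iterated_norm U y (a # as)"
    using Cons.IH[of "y + a *\<^sub>R _"] by (simp add: unit_functional_simps[OF f])
  then show ?case by (simp add: algebra_simps)
qed

text \<open>Finitely many iterated norms are realised simultaneously, up to \<open>\<delta>\<close>, by norms of actual linear
  combinations: each limit is replaced by a point where all the finitely many functions involved are
  close to their limits.\<close>

lemma iterated_norm_approx:
  assumes "finite E" "\<And>e. e \<in> E \<Longrightarrow> length (A e) = r" "\<delta> > 0"
  shows "\<exists>xs. length xs = r \<and>
    (\<forall>e\<in>E. \<bar>norm (Y e + lin_comb (A e) xs) - iterated_norm U (Y e) (A e)\<bar> < \<delta>)"
  using assms(2,3)
proof (induction r arbitrary: A Y \<delta>)
  case 0
  then show ?case by auto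
next
  case (Suc r)
  have A: "A e = hd (A e) # tl (A e)" "length (tl (A e)) = r" if "e \<in> E" for e
    using Suc.prems(1)[OF that] by (cases "A e"; simp)+
  have "\<forall>\<^sub>F x in U. \<bar>iterated_norm U (Y e + hd (A e) *\<^sub>R x) (tl (A e)) - iterated_norm U (Y e) (A e)\<bar> < \<delta>/2"
    if "e \<in> E" for e
    using tendstoD[OF iterated_norm_tendsto[of "Y e" "hd (A e)" "tl (A e)"], of "\<delta>/2"] Suc.prems(2)
    unfolding A(1)[OF that, symmetric] by (simp add: dist_real_def)
  then have "\<forall>\<^sub>F x in U. \<forall>e\<in>E.
      \<bar>iterated_norm U (Y e + hd (A e) *\<^sub>R x) (tl (A e)) - iterated_norm U (Y e) (A e)\<bar> < \<delta>/2"
    using \<open>finite E\<close> by (simp add: eventually_ball_finite_distrib)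
  then obtain x where x: "\<And>e. e \<in> E \<Longrightarrow>
      \<bar>iterated_norm U (Y e + hd (A e) *\<^sub>R x) (tl (A e)) - iterated_norm U (Y e) (A e)\<bar> < \<delta>/2"
    using eventually_happens'[OF ultrafilter_nontrivial] by blast
  obtain xs where xs: "length xs = r" "\<And>e. e \<in> E \<Longrightarrow> \<bar>norm (Y e + hd (A e) *\<^sub>R x + lin_comb (tl (A e)) xs) -
      iterated_norm U (Y e + hd (A e) *\<^sub>R x) (tl (A e))\<bar> < \<delta>/2"
    using Suc.IH[of "\<lambda>e. tl (A e)" "\<delta>/2" "\<lambda>e. Y e + hd (A e) *\<^sub>R x"] A(2) Suc.prems(2) by auto
  show ?case
  proof (intro exI[of _ "x # xs"] conjI ballI)
    fix e assume e: "e \<in> E"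
    have "Y e + lin_comb (A e) (x # xs) = Y e + hd (A e) *\<^sub>R x + lin_comb (tl (A e)) xs"
      by (subst A(1)[OF e]) (simp add: add_ac)
    then have "norm (Y e + lin_comb (A e) (x # xs)) =
        norm (Y e + hd (A e) *\<^sub>R x + lin_comb (tl (A e)) xs)" by (rule arg_cong)
    then show "\<bar>norm (Y e + lin_comb (A e) (x # xs)) - iterated_norm U (Y e) (A e)\<bar> < \<delta>"
      using x[OF e] xs(2)[OF e] by linarith
  qed (use xs in simp)
qed

text \<open>The constant \<open>K\<^sub>m\<close> of James's argument.\<close>

definition alternation_cost :: "nat \<Rightarrow> real" where
  "alternation_cost m = Inf {iterated_norm U 0 as | as. alternating_tails m 1 as}"

lemma alternation_cost_le:
  assumes "alternating_tails m \<sigma> as"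
  shows "\<bar>\<sigma>\<bar> * alternation_cost m \<le> iterated_norm U 0 as"
proof (cases "\<sigma> = 0")
  case True
  then show ?thesis using iterated_norm_nonneg by simp
next
  case False
  have "alternating_tails m 1 (map ((*) (1 / \<sigma>)) as)"
    using alternating_tails_scale[OF assms, of "1 / \<sigma>"] False by simp
  then have "alternation_cost m \<le> iterated_norm U 0 (map ((*) (1 / \<sigma>)) as)"
    unfolding alternation_cost_def
    by (intro cInf_lower) (auto intro!: bdd_belowI[of _ 0] iterated_norm_nonneg)
  then have "\<bar>\<sigma>\<bar> * alternation_cost m \<le> \<bar>\<sigma>\<bar> * iterated_norm U 0 (map ((*) (1 / \<sigma>)) as)"
    by (intro mult_left_mono) auto
  also have "\<dots> = iterated_norm U 0 as"
    using iterated_norm_scale[of "1 / \<sigma>" 0 as] False by simp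
  finally show ?thesis .
qed

lemma alternation_cost_linear: "alternation_cost (Suc m) \<le> 2 * M * real (Suc m)"
proof -
  obtain as where as: "alternating_tails (Suc m) 1 as" "(\<Sum>a\<leftarrow>as. \<bar>a\<bar>) \<le> 2 * real (Suc m)"
    using alternating_tails_exists[of m 1] by auto
  have "M \<ge> 0"
    using eventually_happens'[OF ultrafilter_nontrivial bdd] by (auto intro: order_trans[OF norm_ge_zero])
  then have "M * (\<Sum>a\<leftarrow>as. \<bar>a\<bar>) \<le> M * (2 * real (Suc m))" using as(2) by (intro mult_left_mono)
  then show ?thesis
    using alternation_cost_le[OF as(1)] iterated_norm_upper[of 0 as] by (simp add: algebra_simps)
qed

lemma alternation_cost_approx:
  assumes "alternation_cost (Suc m) < b"
  obtains as where "alternating_tails (Suc m) 1 as" "iterated_norm U 0 as < b"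
proof -
  have "{iterated_norm U 0 as | as. alternating_tails (Suc m) 1 as} \<noteq> {}"
    using alternating_tails_exists[of m 1] by blast
  from cInf_lessD[OF this] assms that show thesis
    unfolding alternation_cost_def by blast
qed

text \<open>The hypothesis says that \<open>U\<close>, as a point of the bidual, has distance at least \<open>\<theta>\<close> from every point of
  the space. It gives the lower bound \<open>\<theta>\<close> for the alternation costs; with the linear upper bound, two
  consecutive costs have ratio close to 1, and the interleaved copies of a nearly optimal
  sequence for the larger cost, realised in the space and normalised, are the required vectors.\<close>

lemma sign_change_vectors:
  assumes \<theta>: "\<theta> > 0" "\<And>y. \<exists>f. unit_functional f \<and> Lim U f - f y \<ge> \<theta>" and \<epsilon>: "\<epsilon> > 0"
  shows "\<exists>u :: nat \<Rightarrow> 'a. (\<forall>j<n. norm (u j) \<le> 1) \<and>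
    (\<forall>k\<le>n. norm (\<Sum>j<n. (if j < k then 1 else - 1) *\<^sub>R u j) > real n - \<epsilon>)"
proof -
  have tail: "\<theta> * \<bar>sum_list q\<bar> \<le> iterated_norm U y q" for y q
  proof (cases "sum_list q = 0")
    case True
    then show ?thesis using iterated_norm_nonneg by simp
  next
    case s: False
    let ?s = "sum_list q"
    obtain f where f: "unit_functional f" "Lim U f - f ((- 1 / ?s) *\<^sub>R y) \<ge> \<theta>" using \<theta>(2) by blast
    have f': "unit_functional (\<lambda>x. - f x)" by (rule unit_functional_uminus[OF f(1)])
    have "Lim U (\<lambda>x. - f x) = - Lim U f"
      by (intro tendsto_Lim ultrafilter_nontrivial tendsto_minus functional_tendsto_Lim f)
    then have "\<bar>f y + Lim U f * ?s\<bar> \<le> iterated_norm U y q"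
      using iterated_norm_functional[OF f(1), of y q] iterated_norm_functional[OF f', of y q] by simp
    moreover have "f y + Lim U f * ?s = ?s * (Lim U f - f ((- 1 / ?s) *\<^sub>R y))"
      using s by (simp add: unit_functional_simps[OF f(1)] field_simps)
    moreover have "\<bar>?s\<bar> * \<theta> \<le> \<bar>?s * (Lim U f - f ((- 1 / ?s) *\<^sub>R y))\<bar>"
      using f(2) by (auto simp: abs_mult intro!: mult_left_mono)
    ultimately show ?thesis by (simp add: mult.commute)
  qed
  have tail': "\<theta> * \<bar>sum_list q\<bar> \<le> iterated_norm U y (p @ q)" for y p q
  proof (induction p arbitrary: y)
    case (Cons a p)
    have "\<forall>\<^sub>F x in U. \<theta> * \<bar>sum_list q\<bar> \<le> iterated_norm U (y + a *\<^sub>R x) (p @ q)"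
      using Cons by simp
    then show ?case
      using tendsto_lowerbound[OF iterated_norm_tendsto _ ultrafilter_nontrivial] by simp
  qed (simp add: tail)
  have K1: "\<theta> \<le> alternation_cost (Suc 0)"
    unfolding alternation_cost_def
  proof (rule cInf_greatest)
    show "{iterated_norm U 0 as | as. alternating_tails (Suc 0) 1 as} \<noteq> {}"
      using alternating_tails_exists[of 0 1] by blast
    show "\<theta> \<le> z" if "z \<in> {iterated_norm U 0 as | as. alternating_tails (Suc 0) 1 as}" for z
      using that tail' by auto (metis abs_one mult.right_neutral)
  qed
  have mono: "alternation_cost (Suc m) \<le> alternation_cost (Suc (Suc m))" for m
    unfolding alternation_cost_def[of "Suc (Suc m)"]
  proof (rule cInf_greatest)
    show "{iterated_norm U 0 as | as. alternating_tails (Suc (Suc m)) 1 as} \<noteq> {}"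
      using alternating_tails_exists[of "Suc m" 1] by blast
    fix z assume "z \<in> {iterated_norm U 0 as | as. alternating_tails (Suc (Suc m)) 1 as}"
    then obtain as where "z = iterated_norm U 0 as" "alternating_tails (Suc m) (- 1) as"
      using alternating_tails_Suc[of "Suc m" 1] by blast
    then show "alternation_cost (Suc m) \<le> z" using alternation_cost_le[of "Suc m" "- 1" as] by simp
  qed
  have K_pos: "\<theta> \<le> alternation_cost (Suc m)" for m
    by (induction m) (use K1 mono order_trans in blast)+
  \<comment> \<open>The choice gives \<open>(n - \<epsilon>) (1 + 2 \<delta>) \<le> n - \<delta>\<close>, which the final
      normalisation by \<open>(1 + 2 \<delta>) \<kappa>\<close> requires.\<close>
  define \<delta> where "\<delta> = \<epsilon> / (1 + 2 * real n)"
  have \<delta>: "\<delta> > 0" "\<delta> * (1 + 2 * real n) = \<epsilon>" using \<epsilon> by (auto simp: \<delta>_def)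
  obtain m where m: "alternation_cost (Suc (Suc m)) < (1 + \<delta>) * alternation_cost (Suc m)"
  proof (rule ccontr)
    assume "\<not> thesis"
    then have grow: "(1 + \<delta>) * alternation_cost (Suc m) \<le> alternation_cost (Suc (Suc m))" for m
      using that[of m] by force
    have "\<theta> * (1 + \<delta>) ^ m \<le> alternation_cost (Suc m)" for m
    proof (induction m)
      case (Suc m)
      have "\<theta> * (1 + \<delta>) ^ Suc m = (1 + \<delta>) * (\<theta> * (1 + \<delta>) ^ m)" by simp
      also have "\<dots> \<le> (1 + \<delta>) * alternation_cost (Suc m)" using Suc \<delta> by (intro mult_left_mono) auto
      finally show ?case using grow[of m] by linarith
    qed (use K1 in simp)
    then show False
      using exponential_beats_linear[OF \<theta>(1) \<delta>(1), of "2 * M"] alternation_cost_linear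
      by (meson leD order_trans)
  qed
  define \<kappa> where "\<kappa> = alternation_cost (Suc m)"
  have \<kappa>: "\<kappa> > 0" using K_pos[of m] \<theta> by (simp add: \<kappa>_def)
  obtain as where as: "alternating_tails (Suc (Suc m)) 1 as" "iterated_norm U 0 as < (1 + \<delta>) * \<kappa>"
    using alternation_cost_approx[OF m] unfolding \<kappa>_def by blast
  obtain p Bs where Bs: "as = p @ concat Bs" "alternating_blocks 1 Bs" "length Bs = Suc (Suc m)"
    using alternating_tails_blocks[OF as(1)] by blast
  \<comment> \<open>The prefix \<open>p\<close> is treated as one more block; it precedes all the tails that matter.\<close>
  define cs where "cs = interleave [0..<n] (p # Bs)"
  define coord where "coord j i = (if i = j then 1 else 0 :: real)" for i j :: nat
  define sign where "sign k i = (if i < k then 1 else - 1 :: real)" for i k :: nat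
  have "\<exists>xs :: 'a list. length xs = length cs \<and> (\<forall>w \<in> coord ` {..<n} \<union> sign ` {..n}.
      \<bar>norm (0 + lin_comb (weigh w cs) xs) - iterated_norm U 0 (weigh w cs)\<bar> < \<delta> * \<kappa>)"
    by (rule iterated_norm_approx[where A = "\<lambda>w. weigh w cs" and Y = "\<lambda>_. 0"])
      (use \<delta> \<kappa> in \<open>auto simp: weigh_def\<close>)
  then obtain xs :: "'a list" where xs: "length xs = length cs"
      "\<And>w. w \<in> coord ` {..<n} \<union> sign ` {..n} \<Longrightarrow>
        \<bar>norm (lin_comb (weigh w cs) xs) - iterated_norm U 0 (weigh w cs)\<bar> < \<delta> * \<kappa>"
    unfolding add_0_left by blast
  define z where "z j = lin_comb (weigh (coord j) cs) xs" for j
  have z_le: "norm (z j) \<le> (1 + 2 * \<delta>) * \<kappa>" if "j < n" for j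
  proof -
    have "iterated_norm U 0 (weigh (coord j) cs) = iterated_norm U 0 as"
      using filter_weigh_interleave_unit[OF that, of "p # Bs"] iterated_norm_filter[of 0]
      unfolding cs_def coord_def Bs(1) by (metis concat.simps(2))
    then have "norm (z j) < (1 + \<delta>) * \<kappa> + \<delta> * \<kappa>"
      using xs(2)[of "coord j"] that as(2) unfolding z_def by fastforce
    then show ?thesis by (simp add: algebra_simps)
  qed
  have z_sum: "norm (\<Sum>j<n. sign k j *\<^sub>R z j) > (real n - \<delta>) * \<kappa>" if k: "k \<le> n" for k
  proof -
    have "set cs \<subseteq> UNIV \<times> {..<n}"
      by (auto simp: cs_def interleave_def tag_block_def)
    then have "(\<Sum>j<n. sign k j *\<^sub>R z j) = lin_comb (weigh (sign k) cs) xs"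
      unfolding z_def coord_def using lin_comb_weigh[of cs n xs "sign k"] xs(1) by force
    moreover have "real n * \<kappa> \<le> iterated_norm U 0 (weigh (sign k) cs)"
    proof -
      have split: "[0..<n] = [0..<k] @ [k..<n]"
        using k by (metis le_add_diff_inverse upt_add_eq_append zero_le)
      have s: "sum_list (map (sign k) [0..<k]) = real k" "sum_list (map (sign k) [k..<n]) = - real (n - k)"
        using k by (simp_all add: interv_sum_list_conv_sum_set_nat sign_def)
      have "alternating_tails (Suc m) (- real n) (weigh (sign k) (interleave [0..<n] Bs))"
        using alternating_tails_interleave[OF Bs(2,3), of "sign k" "[0..<k]" "[k..<n]"] k
        unfolding split[symmetric] s by (simp add: of_nat_diff)
      then have "alternating_tails (Suc m) (- real n) (weigh (sign k) cs)"
        unfolding cs_def interleave_Cons weigh_append by (rule alternating_tails_prefix)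
      from alternation_cost_le[OF this] show ?thesis by (simp add: \<kappa>_def)
    qed
    moreover have "\<bar>norm (lin_comb (weigh (sign k) cs) xs) - iterated_norm U 0 (weigh (sign k) cs)\<bar> < \<delta> * \<kappa>"
      using xs(2)[of "sign k"] k by blast
    ultimately show ?thesis by (simp add: algebra_simps)
  qed
  define c where "c = (1 + 2 * \<delta>) * \<kappa>"
  have c: "c > 0" using \<delta> \<kappa> by (simp add: c_def)
  show ?thesis
  proof (intro exI[of _ "\<lambda>j. (1 / c) *\<^sub>R z j"] conjI allI impI)
    show "norm ((1 / c) *\<^sub>R z j) \<le> 1" if "j < n" for j
      using z_le[OF that] c by (simp add: c_def)
    fix k assume k: "k \<le> n"
    have "(real n - \<epsilon>) * c \<le> (real n - \<delta>) * \<kappa>"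
    proof -
      have "(real n - \<epsilon>) * (1 + 2 * \<delta>) \<le> real n - \<delta>"
        using \<delta> \<epsilon> by (simp add: algebra_simps)
      then have "(real n - \<epsilon>) * (1 + 2 * \<delta>) * \<kappa> \<le> (real n - \<delta>) * \<kappa>"
        using \<kappa> by (intro mult_right_mono) auto
      then show ?thesis by (simp add: c_def mult.assoc)
    qed
    then have "real n - \<epsilon> < norm (\<Sum>j<n. sign k j *\<^sub>R z j) / c"
      using z_sum[OF k] c by (simp add: field_simps)
    also have "\<dots> = norm ((1 / c) *\<^sub>R (\<Sum>j<n. sign k j *\<^sub>R z j))" using c by simp
    also have "(1 / c) *\<^sub>R (\<Sum>j<n. sign k j *\<^sub>R z j) = (\<Sum>j<n. sign k j *\<^sub>R (1 / c) *\<^sub>R z j)"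
      by (simp add: scaleR_sum_right mult.commute)
    finally show "norm (\<Sum>j<n. (if j < k then 1 else - 1) *\<^sub>R (1 / c) *\<^sub>R z j) > real n - \<epsilon>"
      by (simp add: sign_def)
  qed
qed

end

text \<open>Without flats the distance from \<open>U\<close> to the space must be 0. Points that nearly attain this distance
  form a Cauchy sequence, since \<open>\<parallel>y - y'\<parallel>\<close> is at most the sum of the distances from \<open>U\<close> to \<open>y\<close> and to
  \<open>y'\<close>; its limit is the weak limit of \<open>U\<close>.\<close>

lemma bounded_ultrafilter_weak_limit:
  fixes U :: "'a::banach filter"
  assumes "E_convex TYPE('a)" and U: "ultrafilter U" and bdd: "\<forall>\<^sub>F x in U. norm x \<le> M"
  obtains x where "\<And>f. unit_functional f \<Longrightarrow> (f \<longlongrightarrow> f x) U"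
proof -
  note tend = functional_tendsto_Lim[OF U bdd] and nontriv = ultrafilter_nontrivial[OF U bdd]
  obtain n \<epsilon> where \<epsilon>: "0 < \<epsilon>" "\<epsilon> < 1" and
    none: "\<nexists>D :: 'a set set. finite D \<and> card D = n \<and> (\<forall>A\<in>D. flat \<epsilon> A) \<and> jointly_complemented D"
    using E_convex_obstruction[OF assms(1)] by blast
  have "\<exists>y. \<forall>f. unit_functional f \<longrightarrow> Lim U f - f y < \<theta>" if "\<theta> > 0" for \<theta>
  proof (rule ccontr)
    assume "\<not> ?thesis"
    then have "\<exists>f. unit_functional f \<and> \<not> Lim U f - f y < \<theta>" for y by blast
    then have "\<exists>f. unit_functional f \<and> Lim U f - f y \<ge> \<theta>" for y by (simp add: not_less)
    from sign_change_vectors[OF U bdd that this \<epsilon>(1), of "Suc n"] sign_change_vectors_imp_flats[OF _ \<epsilon>] none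
    show False by blast
  qed
  then have "\<exists>y. \<forall>f. unit_functional f \<longrightarrow> Lim U f - f y < 1 / real (Suc k)" for k by simp
  then obtain y where y: "\<And>k f. unit_functional f \<Longrightarrow> Lim U f - f (y k) < 1 / real (Suc k)" by metis
  have close: "\<bar>Lim U f - f (y k)\<bar> < 1 / real (Suc k)" if f: "unit_functional f" for f k
  proof -
    have f': "unit_functional (\<lambda>x. - f x)" by (rule unit_functional_uminus[OF f])
    have "Lim U (\<lambda>x. - f x) = - Lim U f" by (intro tendsto_Lim nontriv tendsto_minus tend f)
    then show ?thesis using y[OF f, of k] y[OF f', of k] by linarith
  qed
  have dist: "norm (y k - y l) \<le> 1 / real (Suc k) + 1 / real (Suc l)" for k l
  proof -
    obtain f where f: "unit_functional f" "f (y k - y l) = norm (y k - y l)"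
      using norming_functional by blast
    then show ?thesis
      using close[OF f(1), of k] close[OF f(1), of l] by (simp add: unit_functional_simps[OF f(1)])
  qed
  have "Cauchy y"
  proof (rule CauchyI)
    fix e :: real assume "e > 0"
    then obtain N where N: "1 / real (Suc N) < e / 2" by (metis half_gt_zero nat_approx_posE)
    show "\<exists>N. \<forall>k\<ge>N. \<forall>l\<ge>N. norm (y k - y l) < e"
    proof (intro exI[of _ N] allI impI)
      fix k l assume "N \<le> k" "N \<le> l"
      then have "1 / real (Suc k) \<le> 1 / real (Suc N)" "1 / real (Suc l) \<le> 1 / real (Suc N)"
        by (simp_all add: frac_le)
      then show "norm (y k - y l) < e" using N dist[of k l] by linarith
    qed
  qed
  then obtain x where x: "y \<longlonglongrightarrow> x" by (auto simp: Cauchy_convergent_iff convergent_def)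
  show thesis
  proof (rule that)
    fix f :: "'a \<Rightarrow> real" assume f: "unit_functional f"
    have "(\<lambda>k. f (y k) - f x) \<longlonglongrightarrow> 0"
    proof (rule tendsto_0_le[where K = 1])
      show "(\<lambda>k. y k - x) \<longlonglongrightarrow> 0" using x by (simp add: LIM_zero)
      show "\<forall>\<^sub>F k in sequentially. norm (f (y k) - f x) \<le> norm (y k - x) * 1"
        using unit_functional_abs_le_norm[OF f, of "y _ - x"] by (simp add: unit_functional_simps[OF f])
    qed
    then have "(\<lambda>k. f (y k)) \<longlonglongrightarrow> f x" by (simp add: LIM_zero_iff)
    moreover have "(\<lambda>k. f (y k)) \<longlonglongrightarrow> Lim U f"
    proof (rule LIM_zero_cancel, rule tendsto_0_le[where K = 1])
      show "(\<lambda>k. 1 / real (Suc k)) \<longlonglongrightarrow> 0" by (rule LIMSEQ_Suc[OF lim_1_over_n])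
      show "\<forall>\<^sub>F k in sequentially. norm (f (y k) - Lim U f) \<le> norm (1 / real (Suc k)) * 1"
        using close[OF f] by (simp add: abs_minus_commute less_imp_le)
    qed
    ultimately have "f x = Lim U f" by (rule LIMSEQ_unique)
    then show "(f \<longlongrightarrow> f x) U" using tend[OF f] by simp
  qed
qed

section \<open>Weak limits along ultrafilters\<close>

definition weak_limit :: "'i filter \<Rightarrow> ('i \<Rightarrow> 'a::real_normed_vector) \<Rightarrow> 'a \<Rightarrow> bool" where
  "weak_limit U g x \<longleftrightarrow> (\<forall>f. unit_functional f \<longrightarrow> ((\<lambda>i. f (g i)) \<longlongrightarrow> f x) U)"

lemma weak_limitD: "weak_limit U g x \<Longrightarrow> unit_functional f \<Longrightarrow> ((\<lambda>i. f (g i)) \<longlongrightarrow> f x) U"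
  by (simp add: weak_limit_def)

lemma weak_limit_exists:
  fixes g :: "'i \<Rightarrow> 'a::banach"
  assumes "E_convex TYPE('a)" "ultrafilter U" "\<forall>\<^sub>F i in U. norm (g i) \<le> M"
  obtains x where "weak_limit U g x"
proof -
  have "\<forall>\<^sub>F x in filtermap g U. norm x \<le> M" using assms(3) by (simp add: eventually_filtermap)
  with assms(1) ultrafilter_filtermap[OF assms(2)] obtain x
    where x: "\<And>f. unit_functional f \<Longrightarrow> (f \<longlongrightarrow> f x) (filtermap g U)"
    using bounded_ultrafilter_weak_limit by blast
  then have "weak_limit U g x"
    by (simp add: weak_limit_def filterlim_def filtermap_filtermap)
  then show thesis by (rule that)
qed

lemma weak_limit_norm_le:
  assumes x: "weak_limit U g x" and "U \<noteq> bot"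
    and le: "\<forall>\<^sub>F i in U. norm (g i) \<le> h i" and h: "(h \<longlongrightarrow> r) U"
  shows "norm x \<le> r"
proof -
  obtain f where f: "unit_functional f" "f x = norm x"
    using norming_functional by blast
  have "\<forall>\<^sub>F i in U. f (g i) \<le> h i"
    using le by eventually_elim (rule order_trans[OF unit_functional_le_norm[OF f(1)]])
  then show ?thesis
    using tendsto_le[OF \<open>U \<noteq> bot\<close> h weak_limitD[OF x f(1)]] f(2) by simp
qed

lemma weak_limit_diff:
  assumes "weak_limit U g x" "weak_limit U h y"
  shows "weak_limit U (\<lambda>i. g i - h i) (x - y)"
  unfolding weak_limit_def
proof (intro allI impI)
  fix f :: "'b \<Rightarrow> real" assume f: "unit_functional f"
  have "((\<lambda>i. f (g i) - f (h i)) \<longlongrightarrow> f x - f y) U"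
    using assms f by (intro tendsto_diff weak_limitD)
  then show "((\<lambda>i. f (g i - h i)) \<longlongrightarrow> f (x - y)) U" by (simp add: unit_functional_simps[OF f])
qed

lemma weak_limit_const: "weak_limit U (\<lambda>_. x) x"
  by (simp add: weak_limit_def)

lemma weak_limit_scale:
  assumes "weak_limit U g x"
  shows "weak_limit U (\<lambda>i. c *\<^sub>R g i) (c *\<^sub>R x)"
  unfolding weak_limit_def
proof (intro allI impI)
  fix f :: "'b \<Rightarrow> real" assume f: "unit_functional f"
  have "((\<lambda>i. c * f (g i)) \<longlongrightarrow> c * f x) U"
    using assms f by (intro tendsto_mult_left weak_limitD)
  then show "((\<lambda>i. f (c *\<^sub>R g i)) \<longlongrightarrow> f (c *\<^sub>R x)) U" by (simp add: unit_functional_simps[OF f])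
qed

lemma weak_limit_in_closed_convex:
  assumes x: "weak_limit U g x" and "U \<noteq> bot" and K: "closed K" "convex K"
    and ev: "\<forall>\<^sub>F i in U. g i \<in> K"
  shows "x \<in> K"
proof (rule ccontr)
  assume "x \<notin> K"
  then obtain e where e: "e > 0" "ball x e \<subseteq> - K"
    using K(1) by (metis open_contains_ball open_Compl Compl_iff)
  have "K \<noteq> {}" using eventually_happens'[OF \<open>U \<noteq> bot\<close> ev] by blast
  moreover have "e \<le> norm (c - x)" if "c \<in> K" for c
    using that e(2) by (force simp: dist_norm norm_minus_commute)
  ultimately obtain f where f: "unit_functional f" "\<And>c. c \<in> K \<Longrightarrow> f x + e \<le> f c"
    using separating_functional[OF K(2)] by blast
  have "\<forall>\<^sub>F i in U. f x + e \<le> f (g i)" using ev by eventually_elim (rule f(2))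
  then have "f x + e \<le> f x"
    by (rule tendsto_lowerbound[OF weak_limitD[OF x f(1)] _ \<open>U \<noteq> bot\<close>])
  with e(1) show False by simp
qed

text \<open>A weak-star cluster point of the functionals \<open>F i\<close>.\<close>

lemma unit_functional_ultrafilter_limit:
  fixes F :: "'i \<Rightarrow> 'a::real_normed_vector \<Rightarrow> real"
  assumes U: "ultrafilter U" and F: "\<And>i. unit_functional (F i)"
  shows "((\<lambda>i. F i z) \<longlongrightarrow> Lim U (\<lambda>i. F i z)) U"
    and "unit_functional (\<lambda>z. Lim U (\<lambda>i. F i z))"
proof -
  have nt: "U \<noteq> bot" using U by (simp add: ultrafilter_def)
  have t: "((\<lambda>i. F i z) \<longlongrightarrow> Lim U (\<lambda>i. F i z)) U" for z
    by (rule ultrafilter_tendsto_Lim[OF U])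
      (use unit_functional_abs_le_norm[OF F] in \<open>auto intro: always_eventually\<close>)
  then show "((\<lambda>i. F i z) \<longlongrightarrow> Lim U (\<lambda>i. F i z)) U" .
  show "unit_functional (\<lambda>z. Lim U (\<lambda>i. F i z))"
    unfolding unit_functional_def
  proof (intro conjI allI linearI)
    show "Lim U (\<lambda>i. F i (x + y)) = Lim U (\<lambda>i. F i x) + Lim U (\<lambda>i. F i y)" for x y
      using tendsto_Lim[OF nt tendsto_add[OF t[of x] t[of y]]]
      by (simp add: unit_functional_simps[OF F])
    show "Lim U (\<lambda>i. F i (c *\<^sub>R x)) = c *\<^sub>R Lim U (\<lambda>i. F i x)" for c x
      using tendsto_Lim[OF nt tendsto_mult_left[OF t[of x], of c]]
      by (simp add: unit_functional_simps[OF F])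
    show "Lim U (\<lambda>i. F i x) \<le> norm x" for x
      by (rule tendsto_upperbound[OF t _ nt]) (simp add: unit_functional_le_norm[OF F])
  qed
qed

section \<open>Minimal invariant sets\<close>

definition invariant_convex :: "('a::real_normed_vector \<Rightarrow> 'a) \<Rightarrow> 'a set \<Rightarrow> bool" where
  "invariant_convex T K \<longleftrightarrow> K \<noteq> {} \<and> closed K \<and> convex K \<and> T ` K \<subseteq> K"

lemma minimal_invariant_convex_exists:
  fixes C :: "'a::banach set"
  assumes E: "E_convex TYPE('a)" and C: "invariant_convex T C" "bounded C"
  obtains K where "K \<subseteq> C" "invariant_convex T K"
    "\<And>L. invariant_convex T L \<Longrightarrow> L \<subseteq> K \<Longrightarrow> L = K"
proof -
  define A where "A = {K. K \<subseteq> C \<and> invariant_convex T K}"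
  have "\<exists>m\<in>A. \<forall>a\<in>A. a \<subseteq> m \<longrightarrow> a = m"
  proof (rule predicate_Zorn[where P = "\<lambda>a b. b \<subseteq> a"])
    show "partial_order_on A (relation_of (\<lambda>a b. b \<subseteq> a) A)"
      by (auto simp: partial_order_on_def preorder_on_def refl_on_def trans_def antisym_def
          relation_of_def)
  next
    fix \<S> assume "\<S> \<in> Chains (relation_of (\<lambda>a b. b \<subseteq> a) A)"
    then have SA: "\<S> \<subseteq> A" and ch: "\<And>a b. a \<in> \<S> \<Longrightarrow> b \<in> \<S> \<Longrightarrow> a \<subseteq> b \<or> b \<subseteq> a"
      by (auto simp: Chains_def relation_of_def)
    show "\<exists>u\<in>A. \<forall>a\<in>\<S>. u \<subseteq> a"
    proof (cases "\<S> = {}")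
      case True
      then show ?thesis using C by (auto simp: A_def)
    next
      case False
      have inv: "invariant_convex T S" "S \<subseteq> C" if "S \<in> \<S>" for S
        using that SA by (auto simp: A_def)
      have "{} \<notin> \<S>" using inv by (auto simp: invariant_convex_def)
      then obtain U where U: "ultrafilter U" "\<And>S. S \<in> \<S> \<Longrightarrow> \<forall>\<^sub>F x in U. x \<in> S"
        using ultrafilter_containing_chain[OF False ch] by blast
      obtain S where S: "S \<in> \<S>" using False by blast
      obtain M where M: "\<And>x. x \<in> C \<Longrightarrow> norm x \<le> M" using C(2) by (auto simp: bounded_iff)
      have "\<forall>\<^sub>F x in U. norm x \<le> M"
        using U(2)[OF S] by eventually_elim (use inv(2)[OF S] M in blast)
      then obtain z where z: "weak_limit U (\<lambda>x. x) z"
        using weak_limit_exists[OF E U(1), of "\<lambda>x. x"] by blast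
      have "z \<in> S" if "S \<in> \<S>" for S
      proof (rule weak_limit_in_closed_convex[OF z])
        show "U \<noteq> bot" using U(1) by (simp add: ultrafilter_def)
      qed (use inv(1)[OF that] U(2)[OF that] in \<open>auto simp: invariant_convex_def\<close>)
      then have "invariant_convex T (\<Inter>\<S>)"
        using inv(1) unfolding invariant_convex_def by (auto intro!: closed_Inter convex_Inter) blast
      then show ?thesis using inv(2) S by (intro bexI[of _ "\<Inter>\<S>"]) (auto simp: A_def)
    qed
  qed
  then show thesis using that by (auto simp: A_def) 
qed

section \<open>Almost fixed points\<close>

text \<open>Iteration of the contraction \<open>z \<mapsto> (1 - s) T z + s a\<close> that starts from the anchor \<open>a\<close> itself.\<close>

definition averaged_iterate :: "('a::real_vector \<Rightarrow> 'a) \<Rightarrow> real \<Rightarrow> nat \<Rightarrow> 'a \<Rightarrow> 'a" where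
  "averaged_iterate T s k a = ((\<lambda>z. (1 - s) *\<^sub>R T z + s *\<^sub>R a) ^^ k) a"

lemma averaged_iterate_simps [simp]:
  "averaged_iterate T s 0 a = a"
  "averaged_iterate T s (Suc k) a = (1 - s) *\<^sub>R T (averaged_iterate T s k a) + s *\<^sub>R a"
  by (simp_all add: averaged_iterate_def)

context
  fixes T :: "'a::banach \<Rightarrow> 'a" and K :: "'a set"
  assumes K: "invariant_convex T K" "bounded K" and T: "nonexpansive_on K T"
begin

lemma invariant_convex_image: "x \<in> K \<Longrightarrow> T x \<in> K"
  using K by (auto simp: invariant_convex_def)

lemma invariant_convex_convex: "convex K"
  using K(1) by (simp add: invariant_convex_def)

lemma nonexpansive_onD: "x \<in> K \<Longrightarrow> y \<in> K \<Longrightarrow> norm (T x - T y) \<le> norm (x - y)"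
  using T by (simp add: nonexpansive_on_def)

lemma norm_le_diameter: "x \<in> K \<Longrightarrow> y \<in> K \<Longrightarrow> norm (x - y) \<le> diameter K"
  using diameter_bounded_bound[OF K(2)] by (simp add: dist_norm)

context
  fixes s :: real
  assumes s: "0 < s" "s < 1"
begin

lemma averaged_iterate_closed: "a \<in> K \<Longrightarrow> averaged_iterate T s k a \<in> K"
proof (induction k)
  case (Suc k)
  then show ?case
    using s unfolding averaged_iterate_simps
    by (intro convexD[OF invariant_convex_convex] invariant_convex_image) auto
qed simp

lemma norm_convex_comb_le:
  "norm x \<le> r \<Longrightarrow> norm y \<le> t \<Longrightarrow> norm ((1 - s) *\<^sub>R x + s *\<^sub>R y) \<le> (1 - s) * r + s * t"
  using s by (intro norm_triangle_le add_mono) (auto intro: mult_left_mono)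

lemma averaged_iterate_nonexpansive:
  assumes "a \<in> K" "b \<in> K"
  shows "norm (averaged_iterate T s k a - averaged_iterate T s k b) \<le> norm (a - b)"
proof (induction k)
  case (Suc k)
  let ?a = "averaged_iterate T s k a" and ?b = "averaged_iterate T s k b"
  have "norm (T ?a - T ?b) \<le> norm (a - b)"
    using Suc nonexpansive_onD averaged_iterate_closed assms order_trans by blast
  from norm_convex_comb_le[OF this order_refl, of "a - b"] show ?case
    by (simp add: algebra_simps)
qed simp

lemma averaged_iterate_near:
  assumes "a \<in> K" "x \<in> K"
  shows "norm (averaged_iterate T s k a - x) \<le> norm (a - x) + real k * norm (T x - x)"
proof (induction k)
  case (Suc k)
  let ?z = "averaged_iterate T s k a"
  let ?r = "norm (a - x) + real (Suc k) * norm (T x - x)"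
  have "norm (T ?z - x) \<le> norm (T ?z - T x) + norm (T x - x)"
    using norm_triangle_ineq[of "T ?z - T x" "T x - x"] by simp
  also have "norm (T ?z - T x) \<le> norm (?z - x)"
    using assms by (intro nonexpansive_onD averaged_iterate_closed)
  finally have "norm (T ?z - x) \<le> ?r" using Suc by (simp add: algebra_simps)
  from norm_convex_comb_le[OF this, of "a - x" ?r] show ?case
    by (simp add: algebra_simps)
qed simp

lemma averaged_iterate_step:
  assumes "a \<in> K"
  shows "norm (averaged_iterate T s (Suc k) a - averaged_iterate T s k a) \<le> (1 - s) ^ k * diameter K"
proof (induction k)
  case 0
  then show ?case
    using norm_le_diameter[of "averaged_iterate T s 1 a" a] averaged_iterate_closed[OF assms, of 1] assms
    by simp
next
  case (Suc k)
  let ?z = "averaged_iterate T s k a" and ?z' = "averaged_iterate T s (Suc k) a"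
  have "averaged_iterate T s (Suc (Suc k)) a - ?z' = (1 - s) *\<^sub>R (T ?z' - T ?z)"
    by (subst (1 2) averaged_iterate_simps(2)) (simp add: algebra_simps)
  then have "norm (averaged_iterate T s (Suc (Suc k)) a - ?z') = (1 - s) * norm (T ?z' - T ?z)"
    using s by simp
  also have "\<dots> \<le> (1 - s) * ((1 - s) ^ k * diameter K)"
    using s by (intro mult_left_mono order_trans[OF nonexpansive_onD Suc] averaged_iterate_closed assms) auto
  finally show ?case by simp
qed

lemma averaged_iterate_residual:
  assumes "a \<in> K"
  shows "norm (T (averaged_iterate T s k a) - averaged_iterate T s k a) \<le> ((1 - s) ^ k + s) * diameter K"
proof -
  let ?z = "averaged_iterate T s k a"
  have "T ?z - ?z = (averaged_iterate T s (Suc k) a - ?z) + s *\<^sub>R (T ?z - a)"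
    by (simp add: algebra_simps)
  also have "norm \<dots> \<le> (1 - s) ^ k * diameter K + s * diameter K"
    using s assms
    by (intro norm_triangle_le add_mono averaged_iterate_step)
      (auto intro!: mult_left_mono norm_le_diameter invariant_convex_image averaged_iterate_closed)
  finally show ?thesis by (simp add: algebra_simps)
qed

end

text \<open>The number \<open>k\<close> of steps does not depend on the starting point. This uniformity makes
  \<open>averaged_iterate T s k\<close> a single nonexpansive map into the set of almost fixed points.\<close>

lemma averaged_iterate_almost_fixed:
  assumes "\<delta> > 0"
  obtains s k where "0 < s" "s < 1"
    "\<And>a. a \<in> K \<Longrightarrow> norm (T (averaged_iterate T s k a) - averaged_iterate T s k a) < \<delta>"
proof -
  \<comment> \<open>Adding 1 avoids division by 0.\<close>
  define D where "D = diameter K + 1"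
  have D: "D > 0" "diameter K \<le> D" using diameter_ge_0[OF K(2)] by (simp_all add: D_def)
  \<comment> \<open>The residual of the \<open>k\<close>-th iterate is at most \<open>((1 - s) ^ k + s) D\<close>: \<open>s\<close> makes the
      second summand small, then \<open>k\<close> the first.\<close>
  define s where "s = min (1/2) (\<delta> / (4 * D))"
  have s: "0 < s" "s < 1" "s * D \<le> \<delta> / 4" using assms D by (auto simp: s_def min_def field_simps)
  obtain k where k: "(1 - s) ^ k < \<delta> / (4 * D)"
    using real_arch_pow_inv[of "\<delta> / (4 * D)" "1 - s"] s assms D by auto
  show thesis
  proof (rule that[OF s(1,2)])
    fix a assume "a \<in> K"
    then have "norm (T (averaged_iterate T s k a) - averaged_iterate T s k a) \<le> ((1 - s) ^ k + s) * diameter K"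
      by (rule averaged_iterate_residual[OF s(1,2)])
    also have "\<dots> \<le> ((1 - s) ^ k + s) * D" using s D by (intro mult_left_mono) auto
    also have "\<dots> < \<delta>"
    proof -
      have "(1 - s) ^ k * D < \<delta> / 4" using k D by (simp add: field_simps)
      then show ?thesis using s(3) assms by (simp add: distrib_right)
    qed
    finally show "norm (T (averaged_iterate T s k a) - averaged_iterate T s k a) < \<delta>" .
  qed
qed

lemma almost_fixed_ultrafilter:
  assumes "\<And>\<delta>. \<delta> > 0 \<Longrightarrow> \<exists>x\<in>S. norm (T x - x) < \<delta>"
  obtains U where "ultrafilter U" "\<forall>\<^sub>F x in U. x \<in> S" "((\<lambda>x. norm (T x - x)) \<longlongrightarrow> 0) U"
proof -
  define \<S> where "\<S> = (\<lambda>\<delta>. {x \<in> S. norm (T x - x) < \<delta>}) ` {0<..}"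
  have ne: "\<S> \<noteq> {}" by (auto simp: \<S>_def)
  have chain: "A \<subseteq> B \<or> B \<subseteq> A" if "A \<in> \<S>" "B \<in> \<S>" for A B
  proof -
    from that obtain \<delta> \<delta>' where AB: "A = {x \<in> S. norm (T x - x) < \<delta>}" "B = {x \<in> S. norm (T x - x) < \<delta>'}"
      unfolding \<S>_def by blast
    show ?thesis unfolding AB by (cases "\<delta> \<le> \<delta>'") auto
  qed
  have "{} \<notin> \<S>"
  proof
    assume "{} \<in> \<S>"
    then obtain \<delta> where "\<delta> > 0" "{x \<in> S. norm (T x - x) < \<delta>} = {}" unfolding \<S>_def by auto
    then show False using assms[of \<delta>] by blast
  qed
  then obtain U where U: "ultrafilter U" "\<And>A. A \<in> \<S> \<Longrightarrow> \<forall>\<^sub>F x in U. x \<in> A"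
    using ultrafilter_containing_chain[OF ne chain] by blast
  have ev: "\<forall>\<^sub>F x in U. x \<in> S \<and> norm (T x - x) < \<delta>" if "\<delta> > 0" for \<delta>
    using U(2)[of "{x \<in> S. norm (T x - x) < \<delta>}"] that by (auto simp: \<S>_def)
  show thesis
  proof (rule that[OF U(1)])
    show "\<forall>\<^sub>F x in U. x \<in> S" using ev[of 1] by (auto elim: eventually_mono)
    show "((\<lambda>x. norm (T x - x)) \<longlongrightarrow> 0) U"
    proof (rule tendstoI)
      fix e :: real assume "e > 0"
      from ev[OF this] show "\<forall>\<^sub>F x in U. dist (norm (T x - x)) 0 < e"
        by eventually_elim simp
    qed
  qed
qed

context
  assumes minimal: "\<And>L. invariant_convex T L \<Longrightarrow> L \<subseteq> K \<Longrightarrow> L = K"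
begin

text \<open>By minimality \<open>K\<close> is the closed convex hull of \<open>T ` K\<close>. Hence the points of \<open>K\<close> whose distance to
  all points of \<open>K\<close> is at most \<open>\<rho>\<close> form an invariant set, which is empty or all of \<open>K\<close>.\<close>

lemma minimal_diametral:
  assumes "y \<in> K" "\<And>z. z \<in> K \<Longrightarrow> norm (y - z) \<le> \<rho>"
  shows "diameter K \<le> \<rho>"
proof -
  let ?H = "closure (convex hull (T ` K))"
  have clK: "closed K" "convex K" using K by (auto simp: invariant_convex_def)
  have sub: "?H \<subseteq> K"
    using K by (intro closure_minimal hull_minimal) (auto simp: invariant_convex_def)
  have "invariant_convex T ?H"
    unfolding invariant_convex_def
  proof (intro conjI)
    show "?H \<noteq> {}" using K by (auto simp: invariant_convex_def)
    show "T ` ?H \<subseteq> ?H"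
      using sub hull_subset[of "T ` K" convex] closure_subset[of "convex hull (T ` K)"] by blast
  qed (auto intro: convex_closure convex_convex_hull)
  then have H: "?H = K" using sub by (rule minimal)
  define L where "L = K \<inter> (\<Inter>z\<in>K. cball z \<rho>)"
  have mem: "x \<in> L \<longleftrightarrow> x \<in> K \<and> (\<forall>z\<in>K. norm (x - z) \<le> \<rho>)" for x
    by (auto simp: L_def dist_norm norm_minus_commute)
  have "invariant_convex T L"
    unfolding invariant_convex_def
  proof (intro conjI)
    show "L \<noteq> {}" using assms mem by blast
    show "closed L" "convex L"
      unfolding L_def using clK by (auto intro!: closed_Int closed_INT convex_Int convex_INT)
    show "T ` L \<subseteq> L"
    proof
      fix x' assume "x' \<in> T ` L"
      then obtain x where x: "x' = T x" "x \<in> L" by blast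
      have "T ` K \<subseteq> cball (T x) \<rho>"
      proof
        fix z' assume "z' \<in> T ` K"
        then obtain z where "z' = T z" "z \<in> K" by blast
        then show "z' \<in> cball (T x) \<rho>"
          using x nonexpansive_onD[of x z] by (auto simp: mem dist_norm intro: order_trans)
      qed
      then have "?H \<subseteq> cball (T x) \<rho>" by (intro closure_minimal hull_minimal) auto
      then show "x' \<in> L" using x invariant_convex_image H by (auto simp: mem dist_norm)
    qed
  qed
  then have "L = K" by (rule minimal) (simp add: L_def)
  then show ?thesis
    using mem assms(1) by (intro diameter_le) (auto simp: dist_norm)
qed

context
  assumes E: "E_convex TYPE('a)"
begin

lemma invariant_convex_weak_limit:
  assumes "ultrafilter U" "\<forall>\<^sub>F i in U. g i \<in> K"
  obtains z where "weak_limit U g z" "z \<in> K"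
proof -
  obtain M where "\<And>x. x \<in> K \<Longrightarrow> norm x \<le> M" using K(2) by (auto simp: bounded_iff)
  then have "\<forall>\<^sub>F i in U. norm (g i) \<le> M" using assms(2) by (auto elim: eventually_mono)
  then obtain z where z: "weak_limit U g z" using weak_limit_exists[OF E assms(1)] by blast
  moreover have "z \<in> K"
    using weak_limit_in_closed_convex[OF z] assms K by (auto simp: ultrafilter_def invariant_convex_def)
  ultimately show thesis by (rule that)
qed

text \<open>The points of \<open>K\<close> whose asymptotic distance from \<open>U\<close> is at most \<open>r\<close> form an invariant closed convex
  set, because \<open>U\<close> consists of almost fixed points. So they are all of \<open>K\<close>, and the weak limit \<open>z\<close> of \<open>U\<close> is
  within \<open>r\<close> of every point of \<open>K\<close>, which \<open>minimal_diametral\<close> only allows for \<open>r \<ge> diameter K\<close>.\<close>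

lemma goebel_karlovitz:
  assumes U: "ultrafilter U" "\<forall>\<^sub>F x in U. x \<in> K" "((\<lambda>x. norm (T x - x)) \<longlongrightarrow> 0) U"
    and y: "y \<in> K" "\<forall>\<^sub>F x in U. norm (x - y) \<le> r"
  shows "diameter K \<le> r"
proof -
  have nt: "U \<noteq> bot" using U(1) by (simp add: ultrafilter_def)
  have clK: "closed K" "convex K" using K by (auto simp: invariant_convex_def)
  define L where "L = {y \<in> K. \<forall>e>0. \<forall>\<^sub>F x in U. norm (x - y) \<le> r + e}"
  have LD: "\<forall>\<^sub>F x in U. norm (x - y) \<le> r + e" if "y \<in> L" "e > 0" for y e
    using that by (simp add: L_def)
  have "invariant_convex T L"
    unfolding invariant_convex_def
  proof (intro conjI)
    have "y \<in> L" using y by (auto simp: L_def elim: eventually_mono)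
    then show "L \<noteq> {}" by blast
    show "convex L"
    proof (rule convexI)
      fix a b and u v :: real assume ab: "a \<in> L" "b \<in> L" "0 \<le> u" "0 \<le> v" "u + v = 1"
      have "\<forall>\<^sub>F x in U. norm (x - (u *\<^sub>R a + v *\<^sub>R b)) \<le> r + e" if e: "e > 0" for e
        using LD[OF ab(1) e] LD[OF ab(2) e]
      proof eventually_elim
        case (elim x)
        have "convex (cball x (r + e))" by simp
        from convexD[OF this, of a b u v] elim ab show ?case by (simp add: dist_norm)
      qed
      moreover have "u *\<^sub>R a + v *\<^sub>R b \<in> K" using ab clK by (intro convexD) (auto simp: L_def)
      ultimately show "u *\<^sub>R a + v *\<^sub>R b \<in> L" by (simp add: L_def)
    qed
    show "closed L"
      unfolding closed_sequential_limits
    proof (intro allI impI)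
      fix a l assume a: "(\<forall>n. a n \<in> L) \<and> a \<longlonglongrightarrow> l"
      have "\<forall>\<^sub>F x in U. norm (x - l) \<le> r + e" if e: "e > 0" for e
      proof -
        obtain n where n: "dist (a n) l < e/2"
          using a e by (meson half_gt_zero lim_sequentially order_refl)
        have "\<forall>\<^sub>F x in U. norm (x - a n) \<le> r + e/2" using a e by (intro LD) auto
        then show ?thesis
        proof eventually_elim
          case (elim x)
          have "norm (x - l) \<le> norm (x - a n) + norm (a n - l)"
            using norm_triangle_ineq[of "x - a n" "a n - l"] by simp
          then show ?case using elim n by (simp add: dist_norm)
        qed
      qed
      moreover have "l \<in> K" using a clK(1) unfolding closed_sequential_limits by (auto simp: L_def)
      ultimately show "l \<in> L" by (simp add: L_def)
    qed
    show "T ` L \<subseteq> L"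
    proof
      fix b' assume "b' \<in> T ` L"
      then obtain b where b: "b' = T b" "b \<in> L" by blast
      then have bK: "b \<in> K" by (simp add: L_def)
      have "\<forall>\<^sub>F x in U. norm (x - T b) \<le> r + e" if e: "e > 0" for e
      proof -
        have "\<forall>\<^sub>F x in U. norm (T x - x) < e/2" using order_tendstoD(2)[OF U(3), of "e/2"] e by simp
        moreover have "\<forall>\<^sub>F x in U. norm (x - b) \<le> r + e/2" using b e by (intro LD) auto
        ultimately show ?thesis using U(2)
        proof eventually_elim
          case (elim x)
          have "norm (x - T b) \<le> norm (x - T x) + norm (T x - T b)"
            using norm_triangle_ineq[of "x - T x" "T x - T b"] by simp
          then show ?case using elim nonexpansive_onD[OF elim(3) bK] by (simp add: norm_minus_commute)
        qed
      qed
      then show "b' \<in> L" using b bK invariant_convex_image by (simp add: L_def)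
    qed
  qed
  then have "L = K" by (rule minimal) (auto simp: L_def)
  obtain z where z: "weak_limit U (\<lambda>x. x) z" "z \<in> K"
    using invariant_convex_weak_limit[OF U(1,2)] by blast
  show ?thesis
  proof (rule minimal_diametral[OF z(2)])
    fix b assume "b \<in> K"
    show "norm (z - b) \<le> r"
    proof (rule field_le_epsilon)
      fix e :: real assume "e > 0"
      then have "\<forall>\<^sub>F x in U. norm (x - b) \<le> r + e" using LD \<open>b \<in> K\<close> \<open>L = K\<close> by blast
      then show "norm (z - b) \<le> r + e"
        by (rule weak_limit_norm_le[OF weak_limit_diff[OF z(1) weak_limit_const] nt _ tendsto_const])
    qed
  qed
qed

text \<open>The uniform form of \<open>goebel_karlovitz\<close>: almost fixed points violating the bound for every \<open>\<delta>\<close> would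
  support an ultrafilter.\<close>

lemma almost_fixed_points_far:
  assumes "y \<in> K" "\<eta> > 0"
  obtains \<delta> where "\<delta> > 0" "\<And>z. z \<in> K \<Longrightarrow> norm (T z - z) < \<delta> \<Longrightarrow> norm (z - y) > diameter K - \<eta>"
proof (rule ccontr)
  let ?S = "{z \<in> K. norm (z - y) \<le> diameter K - \<eta>}"
  note far = that
  assume "\<not> thesis"
  have "\<exists>x\<in>?S. norm (T x - x) < \<delta>" if "\<delta> > 0" for \<delta>
  proof (rule ccontr)
    assume "\<not> ?thesis"
    then have "norm (z - y) > diameter K - \<eta>" if "z \<in> K" "norm (T z - z) < \<delta>" for z
      using that by (auto simp: not_less not_le)
    with \<open>\<not> thesis\<close> far[OF \<open>\<delta> > 0\<close>] show False by blast
  qed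
  then obtain U where U: "ultrafilter U" "\<forall>\<^sub>F x in U. x \<in> ?S" "((\<lambda>x. norm (T x - x)) \<longlongrightarrow> 0) U"
    using almost_fixed_ultrafilter[of ?S] by blast
  have "\<forall>\<^sub>F x in U. x \<in> K" "\<forall>\<^sub>F x in U. norm (x - y) \<le> diameter K - \<eta>"
    using U(2) by (auto elim: eventually_mono)
  with U(1,3) assms(1) have "diameter K \<le> diameter K - \<eta>" by (intro goebel_karlovitz)
  with assms(2) show False by simp
qed

text \<open>Each \<open>w x\<close> is split as \<open>w x - p = (w x - q) + (q - p)\<close> with both parts of norm at most \<open>d / 2\<close>, while
  the sum has norm almost \<open>d\<close>; a functional that norms the sum almost norms both parts. The second
  part does not depend on \<open>x\<close>, and the first part tends weakly to 0 while differences of first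
  parts still have norm at most \<open>d / 2\<close>.\<close>

lemma flats_from_minimal_set:
  assumes d: "diameter K > 0" and \<epsilon>: "0 < \<epsilon>" "\<epsilon> < 1"
  shows "\<exists>D :: 'a set set. finite D \<and> card D = n \<and> (\<forall>A\<in>D. flat \<epsilon> A) \<and> jointly_complemented D"
proof -
  define d where "d = diameter K"
  have d0: "d > 0" using d by (simp add: d_def)
  obtain U where U: "ultrafilter U" "\<forall>\<^sub>F x in U. x \<in> K" "((\<lambda>x. norm (T x - x)) \<longlongrightarrow> 0) U"
  proof (rule almost_fixed_ultrafilter)
    show "\<exists>x\<in>K. norm (T x - x) < \<delta>" if "\<delta> > 0" for \<delta>
    proof -
      obtain a where "a \<in> K" using K by (auto simp: invariant_convex_def)
      then show ?thesis
        using averaged_iterate_almost_fixed[OF that] averaged_iterate_closed by metis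
    qed
  qed
  have nt: "U \<noteq> bot" using U(1) by (simp add: ultrafilter_def)
  obtain p where p: "weak_limit U (\<lambda>x. x) p" "p \<in> K" using invariant_convex_weak_limit[OF U(1,2)] by blast
  have "d * \<epsilon> / 4 > 0" using d0 \<epsilon> by simp
  then obtain \<delta> where \<delta>: "\<delta> > 0"
      "\<And>z. z \<in> K \<Longrightarrow> norm (T z - z) < \<delta> \<Longrightarrow> norm (z - p) > d - d * \<epsilon> / 4"
    using almost_fixed_points_far[OF p(2)] unfolding d_def by blast
  obtain s k where s: "0 < s" "s < 1"
    and fixd: "\<And>a. a \<in> K \<Longrightarrow> norm (T (averaged_iterate T s k a) - averaged_iterate T s k a) < \<delta>"
    using averaged_iterate_almost_fixed[OF \<delta>(1)] by blast
  define m where "m x = (1/2) *\<^sub>R x + (1/2) *\<^sub>R p" for x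
  define w where "w x = averaged_iterate T s k (m x)" for x
  have mK: "m x \<in> K" if "x \<in> K" for x
    unfolding m_def using that p(2) by (intro convexD[OF invariant_convex_convex]) auto
  have wK: "w x \<in> K" if "x \<in> K" for x
    unfolding w_def by (rule averaged_iterate_closed[OF s mK[OF that]])
  have w_far: "norm (w x - p) > d - d * \<epsilon> / 4" if "x \<in> K" for x
    using \<delta>(2)[OF wK[OF that]] fixd[OF mK[OF that]] by (simp add: w_def)
  have w_contr: "norm (w x - w y) \<le> d / 2" if "x \<in> K" "y \<in> K" for x y
  proof -
    have "norm (w x - w y) \<le> norm (m x - m y)"
      unfolding w_def by (rule averaged_iterate_nonexpansive[OF s mK[OF that(1)] mK[OF that(2)]])
    also have "m x - m y = (1/2) *\<^sub>R (x - y)" by (simp add: m_def algebra_simps)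
    finally show ?thesis using norm_le_diameter[OF that] by (simp add: d_def)
  qed
  have w_near: "norm (w x - x) \<le> d / 2 + real k * norm (T x - x)" if "x \<in> K" for x
  proof -
    have "norm (w x - x) \<le> norm (m x - x) + real k * norm (T x - x)"
      unfolding w_def by (rule averaged_iterate_near[OF s mK[OF that] that])
    also have "m x - x = (1/2) *\<^sub>R (p - x)"
      by (simp add: m_def algebra_simps flip: scaleR_add_left)
    finally show ?thesis using norm_le_diameter[OF p(2) that] by (simp add: d_def)
  qed
  have "\<forall>\<^sub>F x in U. w x \<in> K" using U(2) by eventually_elim (rule wK)
  then obtain q where q: "weak_limit U w q" "q \<in> K" using invariant_convex_weak_limit[OF U(1)] by blast
  have qp: "norm (q - p) \<le> d / 2"
  proof (rule weak_limit_norm_le[OF weak_limit_diff[OF q(1) p(1)] nt])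
    show "\<forall>\<^sub>F x in U. norm (w x - x) \<le> d / 2 + real k * norm (T x - x)"
      using U(2) by eventually_elim (rule w_near)
    have "((\<lambda>x. d / 2 + real k * norm (T x - x)) \<longlongrightarrow> d / 2 + real k * 0) U"
      by (intro tendsto_intros U(3))
    then show "((\<lambda>x. d / 2 + real k * norm (T x - x)) \<longlongrightarrow> d / 2) U" by simp
  qed
  have wq: "norm (w x - q) \<le> d / 2" if "x \<in> K" for x
  proof -
    have "norm (q - w x) \<le> d / 2"
    proof (rule weak_limit_norm_le[OF weak_limit_diff[OF q(1) weak_limit_const] nt _ tendsto_const])
      show "\<forall>\<^sub>F y in U. norm (w y - w x) \<le> d / 2"
        using U(2) by eventually_elim (rule w_contr[OF _ that])
    qed
    then show ?thesis by (simp add: norm_minus_commute)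
  qed
  define c where "c = (2 / d) *\<^sub>R (q - p)"
  define v where "v x = (2 / d) *\<^sub>R (w x - q)" for x
  have "\<exists>f. unit_functional f \<and> f (w x - p) = norm (w x - p)" for x
    using norming_functional by blast
  then obtain F where F: "\<And>x. unit_functional (F x)" "\<And>x. F x (w x - p) = norm (w x - p)" by metis
  have Fc: "F x c > 1 - \<epsilon> / 2" and Fv: "F x (v x) > 1 - \<epsilon> / 2" if "x \<in> K" for x
  proof -
    have "F x (w x - p) = F x (w x - q) + F x (q - p)" by (simp add: unit_functional_simps[OF F(1)])
    then have "F x (w x - q) + F x (q - p) > d - d * \<epsilon> / 4" using F(2)[of x] w_far[OF that] by simp
    moreover have "F x (w x - q) \<le> d / 2" "F x (q - p) \<le> d / 2"
      using unit_functional_le_norm[OF F(1)] wq[OF that] qp order_trans by blast+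
    ultimately have "F x (q - p) > (d / 2) * (1 - \<epsilon> / 2)" "F x (w x - q) > (d / 2) * (1 - \<epsilon> / 2)"
      by (simp_all add: algebra_simps)
    moreover have "F x c = (2 / d) * F x (q - p)" "F x (v x) = (2 / d) * F x (w x - q)"
      unfolding c_def v_def by (simp_all only: unit_functional_simps(4)[OF F(1)])
    moreover have "(2 / d) * ((d / 2) * (1 - \<epsilon> / 2)) = 1 - \<epsilon> / 2" using d0 by simp
    moreover have "2 / d > 0" using d0 by simp
    ultimately show "F x c > 1 - \<epsilon> / 2" "F x (v x) > 1 - \<epsilon> / 2"
      using mult_strict_left_mono by metis+
  qed
  define \<phi> where "\<phi> z = Lim U (\<lambda>x. F x z)" for z
  have \<phi>: "unit_functional \<phi>" "\<And>z. ((\<lambda>x. F x z) \<longlongrightarrow> \<phi> z) U"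
    unfolding \<phi>_def using unit_functional_ultrafilter_limit[OF U(1) F(1)] by auto
  have "weak_limit U v ((2 / d) *\<^sub>R (q - q))"
    unfolding v_def by (intro weak_limit_scale weak_limit_diff q(1) weak_limit_const)
  then have v0: "weak_limit U v 0" by simp
  have small: "\<forall>\<^sub>F x in U. f (v x) < \<epsilon> / 2" if "unit_functional f" for f
    using order_tendstoD(2)[OF weak_limitD[OF v0 that], of "\<epsilon> / 2"] \<epsilon>
    by (simp add: unit_functional_simps[OF that])
  \<comment> \<open>The points are chosen one after another. A new \<open>x\<close> along \<open>U\<close> makes
      \<open>F (xs i) (v x)\<close> small because \<open>v\<close> tends weakly to 0. It makes \<open>F x (v (xs i))\<close> small because this
      is close to \<open>\<phi> (v (xs i))\<close>, which was made small when \<open>xs i\<close> was chosen.\<close>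
  have "\<exists>xs :: nat \<Rightarrow> 'a. (\<forall>i<n. xs i \<in> K \<and> \<phi> (v (xs i)) < \<epsilon> / 2) \<and>
      (\<forall>i<n. \<forall>j<n. i \<noteq> j \<longrightarrow> F (xs i) (v (xs j)) < \<epsilon> / 2)" for n
  proof (induction n)
    case (Suc n)
    then obtain xs :: "nat \<Rightarrow> 'a" where
      xs: "\<And>i. i < n \<Longrightarrow> xs i \<in> K" "\<And>i. i < n \<Longrightarrow> \<phi> (v (xs i)) < \<epsilon> / 2"
        "\<And>i j. i < n \<Longrightarrow> j < n \<Longrightarrow> i \<noteq> j \<Longrightarrow> F (xs i) (v (xs j)) < \<epsilon> / 2" by blast
    have "\<forall>\<^sub>F x in U. \<forall>i\<in>{..<n}. F x (v (xs i)) < \<epsilon> / 2"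
      using order_tendstoD(2)[OF \<phi>(2) xs(2)] by (intro eventually_ball_finite) auto
    moreover have "\<forall>\<^sub>F x in U. \<forall>i\<in>{..<n}. F (xs i) (v x) < \<epsilon> / 2"
      using small[OF F(1)] by (intro eventually_ball_finite) auto
    ultimately have "\<forall>\<^sub>F x in U. x \<in> K \<and> \<phi> (v x) < \<epsilon> / 2 \<and>
        (\<forall>i\<in>{..<n}. F x (v (xs i)) < \<epsilon> / 2) \<and> (\<forall>i\<in>{..<n}. F (xs i) (v x) < \<epsilon> / 2)"
      using U(2) small[OF \<phi>(1)] by eventually_elim blast
    then obtain x where x: "x \<in> K" "\<phi> (v x) < \<epsilon> / 2"
        "\<And>i. i < n \<Longrightarrow> F x (v (xs i)) < \<epsilon> / 2" "\<And>i. i < n \<Longrightarrow> F (xs i) (v x) < \<epsilon> / 2"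
      using eventually_happens'[OF nt] by blast
    show ?case
      using xs x by (intro exI[of _ "xs(n := x)"]) (auto simp: less_Suc_eq)
  qed simp
  then obtain xs :: "nat \<Rightarrow> 'a" where
    xs: "\<And>i. i < n \<Longrightarrow> xs i \<in> K" "\<And>i j. i < n \<Longrightarrow> j < n \<Longrightarrow> i \<noteq> j \<Longrightarrow> F (xs i) (v (xs j)) < \<epsilon> / 2"
    by metis
  show ?thesis
  proof (rule jointly_complemented_slices[of n "\<lambda>i. F (xs i)"])
    fix i j assume ij: "i < n" "j < n" "i \<noteq> j"
    have "norm c \<le> 1" unfolding c_def norm_scaleR using qp d0 by (simp add: field_simps)
    then show "\<exists>p. norm p \<le> 1 \<and> F (xs i) p > 1 - \<epsilon> \<and> F (xs j) p > 1 - \<epsilon>"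
      using Fc[OF xs(1)[OF ij(1)]] Fc[OF xs(1)[OF ij(2)]] \<epsilon> by (intro exI[of _ c]) simp
    have "v (xs i) - v (xs j) = (2 / d) *\<^sub>R (w (xs i) - w (xs j))"
      by (simp add: v_def flip: scaleR_diff_right)
    then have "norm (v (xs i) - v (xs j)) = (2 / d) * norm (w (xs i) - w (xs j))"
      using d0 by (simp only: norm_scaleR) simp
    moreover have "(2 / d) * norm (w (xs i) - w (xs j)) \<le> (2 / d) * (d / 2)"
      using w_contr[of "xs i" "xs j"] xs(1) ij d0 by (intro mult_left_mono) auto
    ultimately have "norm (v (xs i) - v (xs j)) \<le> 1" using d0 by simp
    moreover have "F (xs i) (v (xs i) - v (xs j)) > 1 - \<epsilon>"
      using Fv[OF xs(1)[OF ij(1)]] xs(2)[OF ij] by (simp add: unit_functional_simps(2)[OF F(1)])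
    moreover have "F (xs j) (v (xs i) - v (xs j)) < - (1 - \<epsilon>)"
      using Fv[OF xs(1)[OF ij(2)]] xs(2)[OF ij(2,1)] ij(3)
      by (simp add: unit_functional_simps(2)[OF F(1)])
    ultimately show "\<exists>q. norm q \<le> 1 \<and> F (xs i) q > 1 - \<epsilon> \<and> F (xs j) q < - (1 - \<epsilon>)"
      by blast
  qed (use F \<epsilon> in auto)
qed

end

end

end

theorem theorem6:
  assumes "E_convex TYPE('a::banach)"
  shows "fixed_point_property TYPE('a)"
  unfolding fixed_point_property_def
proof (intro allI impI)
  fix C :: "'a set" and T
  assume "C \<noteq> {}" "closed C" "bounded C" "convex C" "T ` C \<subseteq> C" and T: "nonexpansive_on C T"
  then have "invariant_convex T C" by (simp add: invariant_convex_def)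
  then obtain K where K: "K \<subseteq> C" "invariant_convex T K"
      "\<And>L. invariant_convex T L \<Longrightarrow> L \<subseteq> K \<Longrightarrow> L = K"
    using minimal_invariant_convex_exists[OF assms] \<open>bounded C\<close> by blast
  have bK: "bounded K" using \<open>bounded C\<close> K(1) by (rule bounded_subset)
  have TK: "nonexpansive_on K T" using T K(1) by (auto simp: nonexpansive_on_def)
  have "diameter K = 0"
  proof (rule ccontr)
    assume "diameter K \<noteq> 0"
    then have d: "diameter K > 0" using diameter_ge_0[OF bK] by simp
    from flats_from_minimal_set[OF K(2) bK TK K(3) assms d] E_convex_obstruction[OF assms]
    show False by metis
  qed
  obtain x where x: "x \<in> K" "T x \<in> K" using K(2) by (auto simp: invariant_convex_def)
  then have "dist (T x) x \<le> 0" using diameter_bounded_bound[OF bK] \<open>diameter K = 0\<close> by metis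
  then show "\<exists>x\<in>C. T x = x" using x(1) K(1) by auto
qed

end
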